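(* Let $d \geq 2$ be an integer and let $X=\mathrm{SL}_d(\mathbb{R})/\mathrm{SL}_d(\mathbb{Z})$. There exist a Zariski-dense probability measure $\mu$ on $\mathrm{SL}_d(\mathbb{R})$ and a point $x \in X$ such that for $\mu^{\otimes \mathbb{N}}$-almost every sequence $(\gamma_n)_{n\ge 0}$ one has both $\gamma_0\cdots \gamma_{n-1}\cdot x \to \infty$ and $\gamma_{n-1}\cdots \gamma_{0}\cdot x \to \infty$ in $X$ as $n \to \infty$. In particular, for every compact subset $M$ of $X$, we have $\mu^{\ast n} \ast \delta_x(M) \to 0$ as $n\to\infty$, and hence the $\mu$-random walk on $X$ is not recurrent in law.
   Context: A probability measure $\mu$ on $\mathrm{SL}_d(\mathbb{R})$ is called Zariski-dense if the semigroup $\Gamma_\mu$ generated by the support of $\mu$ is Zariski-dense in $\mathrm{SL}_d(\mathbb{R})$. The space $X=\mathrm{SL}_d(\mathbb{R})/\mathrm{SL}_d(\mathbb{Z})$ carries the quotient topology, and $\mathrm{SL}_d(\mathbb{R})$ acts on it by left multiplication. A sequence $x_n\in X$ tends to $\infty$ if it eventually leaves every compact subset of $X$. $\mu^{\ast n}$ is the $n$-fold convolution of $\mu$, and $\mu^{\ast n}\ast\delta_x$ is the push-forward of $\mu^{\ast n}$ under $g\mapsto gx$; it is the $n$-th step distribution of the $\mu$-random walk on $X$ started at $x$ (the Markov chain on $X$ with transition probabilities $y\mapsto \mu\ast\delta_y$). The random walk on $X$ induced by $\mu$ is recurrent in law on $X$ if for every $\varepsilon>0$ and $x \in X$ there exist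 a compact $M \subseteq X$ and $n_0 \in \mathbb{N}$ such that $\mu^{\ast n}\ast \delta_x(M)>1-\varepsilon$ for every $n \geq n_0$. *)

theory Defs
  imports "HOL-Probability.Probability"
begin

section \<open>The homogeneous space of unimodular lattices\<close>

text \<open>The dimension d is the cardinality of the finite index type.\<close>

definition SL :: "(real ^ 'n ^ 'n) set" where
  "SL = {A. det A = 1}"

definition SLZ :: "(real ^ 'n ^ 'n) set" where
  "SLZ = {A \<in> SL. \<forall>i j. A $ i $ j \<in> \<int>}"

definition coset :: "real ^ 'n ^ 'n \<Rightarrow> (real ^ 'n ^ 'n) set" where
  "coset g = (\<lambda>h. g ** h) ` SLZ"

definition homog :: "(real ^ 'n ^ 'n) set set" where
  "homog = coset ` SL"

definition act :: "real ^ 'n ^ 'n \<Rightarrow> (real ^ 'n ^ 'n) set \<Rightarrow> (real ^ 'n ^ 'n) set" where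
  "act g x = (\<lambda>a. g ** a) ` x"

definition homog_topology :: "(real ^ 'n ^ 'n) set topology" where
  "homog_topology = topology (\<lambda>U. U \<subseteq> homog \<and> openin (top_of_set SL) {g \<in> SL. coset g \<in> U})"

definition tends_to_infinity :: "(nat \<Rightarrow> (real ^ 'n ^ 'n) set) \<Rightarrow> bool" where
  "tends_to_infinity y \<longleftrightarrow> (\<forall>M. compactin homog_topology M \<longrightarrow> (\<forall>\<^sub>F n in sequentially. y n \<notin> M))"

lemma openin_homog_topology:
  fixes U :: "(real ^ 'n ^ 'n) set set"
  shows "openin homog_topology U \<longleftrightarrow> U \<subseteq> homog \<and> openin (top_of_set SL) {g \<in> SL. coset g \<in> U}"
proof -
  have "istopology (\<lambda>U :: (real ^ 'n ^ 'n) set set. U \<subseteq> homog \<and> openin (top_of_set SL) {g \<in> SL. coset g \<in> U})"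
    unfolding istopology_def
  proof (intro conjI allI impI, goal_cases)
    case (2 S T)
    have "{g \<in> SL. coset g \<in> S \<inter> T} = {g \<in> SL. coset g \<in> S} \<inter> {g \<in> SL. coset g \<in> T}" by auto
    then show ?case using 2 by auto
  next
    case (4 K)
    have "{g \<in> SL. coset g \<in> \<Union>K} = (\<Union>S\<in>K. {g \<in> SL. coset g \<in> S})" by auto
    then show ?case using 4 by (auto intro!: openin_Union)
  qed auto
  then show ?thesis
    by (simp add: homog_topology_def)
qed

lemma topspace_homog_topology [simp]:
  "topspace homog_topology = (homog :: (real ^ 'n ^ 'n) set set)"
proof (rule antisym)
  show "topspace homog_topology \<subseteq> (homog :: (real ^ 'n ^ 'n) set set)"
    by (auto simp: topspace_def openin_homog_topology)
  have "{g \<in> SL. coset g \<in> homog} = (SL :: (real ^ 'n ^ 'n) set)" by (auto simp: homog_def)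
  then have "openin homog_topology (homog :: (real ^ 'n ^ 'n) set set)" by (simp add: openin_homog_topology)
  then show "(homog :: (real ^ 'n ^ 'n) set set) \<subseteq> topspace homog_topology" by (rule openin_subset)
qed

lemma quotient_map_coset: "quotient_map (top_of_set SL) homog_topology coset"
  unfolding quotient_map_def by (auto simp: openin_homog_topology homog_def)

lemma SL_mult: "g \<in> SL \<Longrightarrow> h \<in> SL \<Longrightarrow> g ** h \<in> SL"
  by (simp add: SL_def det_mul)

lemma act_coset: "act g (coset h) = coset (g ** h)"
  by (simp add: act_def coset_def image_image matrix_mul_assoc)

lemma act_homog: "g \<in> SL \<Longrightarrow> x \<in> homog \<Longrightarrow> act g x \<in> homog"
  by (auto simp: homog_def act_coset SL_mult)


section \<open>Zariski-dense measures\<close>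

definition SL_borel :: "(real ^ 'n ^ 'n) measure" where
  "SL_borel = restrict_space borel SL"

definition SL_prob :: "(real ^ 'n ^ 'n) measure \<Rightarrow> bool" where
  "SL_prob \<mu> \<longleftrightarrow> prob_space \<mu> \<and> sets \<mu> = sets SL_borel"

definition supp :: "(real ^ 'n ^ 'n) measure \<Rightarrow> (real ^ 'n ^ 'n) set" where
  "supp \<mu> = {g \<in> SL. \<forall>U. openin (top_of_set SL) U \<longrightarrow> g \<in> U \<longrightarrow> emeasure \<mu> U > 0}"

inductive_set semigroup_gen :: "(real ^ 'n ^ 'n) set \<Rightarrow> (real ^ 'n ^ 'n) set" for S where
  base: "g \<in> S \<Longrightarrow> g \<in> semigroup_gen S"
| mult: "g \<in> semigroup_gen S \<Longrightarrow> h \<in> semigroup_gen S \<Longrightarrow> g ** h \<in> semigroup_gen S"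

definition zariski_closed :: "(real ^ 'n ^ 'n) set \<Rightarrow> bool" where
  "zariski_closed V \<longleftrightarrow>
     (\<exists>P. (\<forall>p\<in>P. real_polynomial_function p) \<and> V = {g \<in> SL. \<forall>p\<in>P. p g = 0})"

definition zariski_dense :: "(real ^ 'n ^ 'n) set \<Rightarrow> bool" where
  "zariski_dense S \<longleftrightarrow> S \<subseteq> SL \<and> zariski_closed hull S = SL"

definition zariski_dense_measure :: "(real ^ 'n ^ 'n) measure \<Rightarrow> bool" where
  "zariski_dense_measure \<mu> \<longleftrightarrow> zariski_dense (semigroup_gen (supp \<mu>))"


section \<open>The random walk\<close>

text \<open>The convolution of HOL-Probability is additive, so the multiplicative one is defined here.\<close>

definition mconv ::
  "(real ^ 'n ^ 'n) measure \<Rightarrow> (real ^ 'n ^ 'n) measure \<Rightarrow> (real ^ 'n ^ 'n) measure" where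
  "mconv \<mu> \<nu> = distr (\<mu> \<Otimes>\<^sub>M \<nu>) SL_borel (\<lambda>(g, h). g ** h)"

primrec conv_pow :: "(real ^ 'n ^ 'n) measure \<Rightarrow> nat \<Rightarrow> (real ^ 'n ^ 'n) measure" where
  "conv_pow \<mu> 0 = return SL_borel (mat 1)"
| "conv_pow \<mu> (Suc n) = mconv \<mu> (conv_pow \<mu> n)"

definition homog_borel :: "(real ^ 'n ^ 'n) set measure" where
  "homog_borel = sigma homog {U. openin homog_topology U}"

definition walk_law ::
  "(real ^ 'n ^ 'n) measure \<Rightarrow> nat \<Rightarrow> (real ^ 'n ^ 'n) set \<Rightarrow> (real ^ 'n ^ 'n) set measure" where
  "walk_law \<mu> n x = distr (conv_pow \<mu> n) homog_borel (\<lambda>g. act g x)"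

definition recurrent_in_law :: "(real ^ 'n ^ 'n) measure \<Rightarrow> bool" where
  "recurrent_in_law \<mu> \<longleftrightarrow>
     (\<forall>\<epsilon>>0. \<forall>x\<in>homog. \<exists>M n0. compactin homog_topology M \<and>
        (\<forall>n\<ge>n0. measure (walk_law \<mu> n x) M > 1 - \<epsilon>))"

text \<open>\<open>rprod \<gamma> n = \<gamma> 0 ** \<dots> ** \<gamma> (n - 1)\<close> and \<open>lprod \<gamma> n = \<gamma> (n - 1) ** \<dots> ** \<gamma> 0\<close>.\<close>

primrec rprod :: "(nat \<Rightarrow> real ^ 'n ^ 'n) \<Rightarrow> nat \<Rightarrow> real ^ 'n ^ 'n" where
  "rprod \<gamma> 0 = mat 1"
| "rprod \<gamma> (Suc n) = rprod \<gamma> n ** \<gamma> n"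

primrec lprod :: "(nat \<Rightarrow> real ^ 'n ^ 'n) \<Rightarrow> nat \<Rightarrow> real ^ 'n ^ 'n" where
  "lprod \<gamma> 0 = mat 1"
| "lprod \<gamma> (Suc n) = \<gamma> n ** lprod \<gamma> n"


text \<open>The maps pushed forward above are measurable, so no \<open>distr\<close> here is degenerate.\<close>

lemma space_SL_borel [simp]: "space SL_borel = SL"
  by (simp add: SL_borel_def space_restrict_space)

lemma continuous_on_matrix_mult_pair:
  "continuous_on UNIV (\<lambda>(g :: real ^ 'n ^ 'n, h :: real ^ 'n ^ 'n). g ** h)"
  unfolding matrix_matrix_mult_def split_beta
  by (intro continuous_intros)

lemma measurable_SL_mult:
  "(\<lambda>(g, h). g ** h) \<in> SL_borel \<Otimes>\<^sub>M SL_borel \<rightarrow>\<^sub>M (SL_borel :: (real ^ 'n ^ 'n) measure)"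
proof -
  have m: "(\<lambda>(g :: real ^ 'n ^ 'n, h :: real ^ 'n ^ 'n). g ** h) \<in> borel \<Otimes>\<^sub>M borel \<rightarrow>\<^sub>M (borel :: (real ^ 'n ^ 'n) measure)"
    unfolding borel_prod
    by (rule borel_measurable_continuous_onI[OF continuous_on_matrix_mult_pair])
  have i: "(\<lambda>x. x) \<in> SL_borel \<rightarrow>\<^sub>M (borel :: (real ^ 'n ^ 'n) measure)"
    unfolding SL_borel_def by (intro measurable_restrict_space1) simp
  have "(\<lambda>p. (fst p, snd p)) \<in> SL_borel \<Otimes>\<^sub>M SL_borel \<rightarrow>\<^sub>M
      (borel :: (real ^ 'n ^ 'n) measure) \<Otimes>\<^sub>M (borel :: (real ^ 'n ^ 'n) measure)"
    by (intro measurable_Pair measurable_compose[OF measurable_fst i]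
        measurable_compose[OF measurable_snd i])
  from measurable_compose[OF this m] show ?thesis
    unfolding SL_borel_def
    by (intro measurable_restrict_space2)
       (auto simp: space_pair_measure space_restrict_space split_beta intro: SL_mult)
qed

lemma measurable_act:
  fixes x :: "(real ^ 'n ^ 'n) set"
  assumes "x \<in> homog"
  shows "(\<lambda>g. act g x) \<in> SL_borel \<rightarrow>\<^sub>M homog_borel"
proof -
  from assms obtain h where h: "h \<in> SL" "x = coset h" by (auto simp: homog_def)
  have *: "{g \<in> SL. act g x \<in> U} \<in> sets SL_borel" if U: "openin homog_topology U" for U
  proof -
    from U obtain T where T: "open T" "{g \<in> SL. coset g \<in> U} = SL \<inter> T"
      by (auto simp: openin_homog_topology openin_open)
    have "continuous_on UNIV (\<lambda>g. g ** h)"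
      unfolding matrix_matrix_mult_def by (intro continuous_intros)
    then have "open ((\<lambda>g. g ** h) -` T)"
      using T(1) by (rule open_vimage[rotated])
    moreover have "{g \<in> SL. act g x \<in> U} = SL \<inter> (\<lambda>g. g ** h) -` T"
      using T(2) h(1) by (auto simp: h(2) act_coset dest: SL_mult)
    ultimately show ?thesis
      by (auto simp: SL_borel_def sets_restrict_space)
  qed
  show ?thesis
    unfolding homog_borel_def
  proof (rule measurable_measure_of)
    show "{U. openin homog_topology U} \<subseteq> Pow homog"
      by (auto simp: openin_homog_topology)
    show "(\<lambda>g. act g x) \<in> space SL_borel \<rightarrow> homog"
      using assms by (auto intro: act_homog)
    fix U :: "(real ^ 'n ^ 'n) set set"
    assume "U \<in> {U. openin homog_topology U}"
    then show "(\<lambda>g. act g x) -` U \<inter> space SL_borel \<in> sets SL_borel"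
      using *[of U] by (simp add: vimage_def Int_def conj_commute)
  qed
qed

end

theory Submission
  imports Defs
begin

text \<open>
  The measure is supported on a sequence \<open>G 0, G 1, \<dots>\<close> of matrices in \<open>SL\<^sub>d(\<rat>)\<close>, with tails so heavy
  that a single factor dominates each product. The index \<open>\<omega>\<close> of a step satisfies \<open>P(\<omega> \<ge> k) = 1/(k + 1)\<close>.
  The expected number of levels \<open>k\<close> at which the running maximum ever ties is finite, so by Borel--Cantelli
  the maximum \<open>k\<close> of the first \<open>n\<close> indices is almost surely unique for all large \<open>n\<close>; moreover
  \<open>n \<le> (k + 2)\<^sup>2\<close>, and \<open>k\<close> is not a square because the record probabilities \<open>1/(j\<^sup>2 + 2)\<close> are summable.
  Both products of the first \<open>n\<close> steps are then of the form \<open>A G(k) B\<close>, where \<open>A\<close> and \<open>B\<close> belong to the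
  finite set of words of length at most \<open>(k + 2)\<^sup>2\<close> in \<open>G 0, \<dots>, G (k - 1)\<close>. As these words are rational, the
  lattices \<open>B \<int>\<^sup>d\<close> all meet one coordinate axis, and \<open>G k\<close> is chosen to contract this axis so strongly that
  \<open>A G(k) B \<int>\<^sup>d\<close> has a very short vector. At the squares, \<open>G\<close> enumerates \<open>SL\<^sub>d(\<rat>)\<close>, which makes the
  support all of \<open>SL\<^sub>d(\<real>)\<close>.
\<close>

section \<open>Mahler's criterion, easy direction\<close>

text \<open>\<open>norm\<close> on matrices is the Frobenius norm, so Cauchy-Schwarz in each row
  gives the bound.\<close>

lemma norm_matrix_vector_mult_le: "norm ((A :: real ^ 'n ^ 'm) *v x) \<le> norm A * norm x"
proof -
  have "norm (A *v x) \<le> L2_set (\<lambda>i. norm (A $ i) * norm x) UNIV"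
    unfolding norm_vec_def [of "A *v x"]
    by (intro L2_set_mono) (simp_all add: matrix_vector_mul_component Cauchy_Schwarz_ineq2)
  also have "\<dots> = norm A * norm x"
    by (simp add: norm_vec_def [of A] L2_set_left_distrib)
  finally show ?thesis .
qed

definition integer_vec :: "real ^ 'n \<Rightarrow> bool" where
  "integer_vec v \<longleftrightarrow> (\<forall>i. v $ i \<in> \<int>)"

lemma norm_integer_vec_ge_1:
  assumes "integer_vec v" "v \<noteq> 0"
  shows "norm v \<ge> 1"
proof -
  obtain i where "v $ i \<noteq> 0" using assms(2) by (auto simp: vec_eq_iff)
  then have "\<bar>v $ i\<bar> \<ge> 1"
    using assms(1) Ints_nonzero_abs_ge1 by (auto simp: integer_vec_def)
  then show ?thesis using component_le_norm_cart[of v i] by linarith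
qed

lemma SLZ_integer_vec: "h \<in> SLZ \<Longrightarrow> integer_vec v \<Longrightarrow> integer_vec (h *v v)"
  by (auto simp: SLZ_def integer_vec_def matrix_vector_mult_def intro!: Ints_sum Ints_mult)

lemma SL_mult_vec_nonzero:
  assumes "g \<in> SL" "v \<noteq> 0"
  shows "g *v v \<noteq> (0 :: real ^ 'n)"
proof -
  have "invertible g" using assms(1) by (simp add: SL_def invertible_det_nz)
  then obtain h where "h ** g = mat 1" by (auto simp: invertible_def)
  then have "h *v (g *v v) = v" by (simp add: matrix_vector_mul_assoc)
  then show ?thesis using assms(2) by auto
qed

text \<open>Matrices whose smallest singular value exceeds \<open>c\<close>; the strict inequality
  makes the set open in \<open>SL\<close>.\<close>

definition expanding :: "real \<Rightarrow> (real ^ 'n ^ 'n) set" where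
  "expanding c = {g \<in> SL. \<forall>v. norm v = 1 \<longrightarrow> norm (g *v v) > c}"

lemma expanding_antimono: "c \<le> c' \<Longrightarrow> expanding c' \<subseteq> expanding c"
  by (force simp: expanding_def)

lemma expanding_norm_ge:
  assumes "g \<in> expanding c"
  shows "norm (g *v v) \<ge> c * norm v"
proof (cases "v = 0")
  case False
  define u where "u = v /\<^sub>R norm v"
  have "norm u = 1" using False by (simp add: u_def)
  then have "norm (g *v u) > c" using assms by (simp add: expanding_def)
  moreover have "g *v v = norm v *\<^sub>R (g *v u)"
    using False by (simp add: u_def matrix_vector_mult_scaleR)
  ultimately show ?thesis
    by (simp add: mult.commute[of c] mult_left_mono less_imp_le)
qed simp

lemma attains_min_norm_mult_vec:
  fixes g :: "real ^ 'n ^ 'm"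
  obtains u where "norm u = 1" "\<And>v. norm v = 1 \<Longrightarrow> norm (g *v u) \<le> norm (g *v v)"
proof -
  have "\<exists>u \<in> sphere 0 1. \<forall>v \<in> sphere (0 :: real ^ 'n) 1. norm (g *v u) \<le> norm (g *v v)"
    by (intro continuous_attains_inf continuous_intros) auto
  then show ?thesis using that by auto
qed

text \<open>By compactness of the sphere the minimum of \<open>norm (g *v v)\<close> is attained, so
  it exceeds \<open>c\<close> by a positive gap. A perturbation of \<open>g\<close> smaller than
  this gap in Frobenius norm keeps all values above \<open>c\<close>.\<close>

lemma openin_expanding: "openin (top_of_set SL) (expanding c :: (real ^ 'n ^ 'n) set)"
proof -
  have "\<exists>e>0. \<forall>g'\<in>SL. dist g' g < e \<longrightarrow> g' \<in> expanding c" if g: "g \<in> expanding c" for g :: "real ^ 'n ^ 'n"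
  proof -
    obtain u where u: "norm u = 1" "\<And>v. norm v = 1 \<Longrightarrow> norm (g *v u) \<le> norm (g *v v)"
      using attains_min_norm_mult_vec by blast
    have pos: "norm (g *v u) > c" using g u(1) by (simp add: expanding_def)
    have "g' \<in> expanding c" if "dist g' g < norm (g *v u) - c" "g' \<in> SL" for g'
      unfolding expanding_def
    proof safe
      fix v :: "real ^ 'n" assume v: "norm v = 1"
      have "norm (g *v v) \<le> norm (g' *v v) + norm ((g - g') *v v)"
        by (metis matrix_vector_mult_diff_rdistrib norm_triangle_sub)
      also have "norm ((g - g') *v v) \<le> norm (g - g')"
        using norm_matrix_vector_mult_le[of "g - g'" v] v by simp
      also have "\<dots> < norm (g *v u) - c" using that(1) by (simp add: dist_norm norm_minus_commute)
      finally show "norm (g' *v v) > c" using u(2)[OF v] by linarith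
    qed (rule that)
    then show ?thesis
      using pos by (intro exI[of _ "norm (g *v u) - c"]) auto
  qed
  moreover have "expanding c \<subseteq> SL" by (auto simp: expanding_def)
  ultimately show ?thesis
    by (simp add: openin_euclidean_subtopology_iff)
qed

text \<open>Injectivity of \<open>g\<close> makes the attained minimum positive. Hence these sets
  exhaust \<open>SL\<close>, which is what the open cover of a compact set requires.\<close>

lemma mem_expanding:
  assumes "g \<in> SL"
  obtains k :: nat where "g \<in> expanding (inverse (real (Suc k)))"
proof -
  obtain u where u: "norm u = 1" "\<And>v. norm v = 1 \<Longrightarrow> norm (g *v u) \<le> norm (g *v v)"
    using attains_min_norm_mult_vec by blast
  have "norm (g *v u) > 0" using SL_mult_vec_nonzero[OF assms, of u] u(1) by force
  then obtain k where "inverse (real (Suc k)) < norm (g *v u)"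
    using reals_Archimedean by blast
  then show ?thesis using that[of k] assms u(2) by (force simp: expanding_def)
qed

section \<open>Integer matrices and their cosets\<close>

lemma SLZ_mult: "h \<in> SLZ \<Longrightarrow> h' \<in> SLZ \<Longrightarrow> h ** h' \<in> SLZ"
  unfolding SLZ_def using SL_mult[of h h'] by (auto simp: matrix_matrix_mult_def intro!: Ints_sum Ints_mult)

lemma mat_1_SLZ: "mat 1 \<in> SLZ"
  by (auto simp: SLZ_def SL_def) (simp add: mat_def)

lemma det_Ints: "(\<And>i j. (A :: real ^ 'n ^ 'n) $ i $ j \<in> \<int>) \<Longrightarrow> det A \<in> \<int>"
  by (auto simp: det_def intro!: Ints_sum Ints_mult Ints_prod)

lemma det_Rats: "(\<And>i j. (A :: real ^ 'n ^ 'n) $ i $ j \<in> \<rat>) \<Longrightarrow> det A \<in> \<rat>"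
  by (auto simp: det_def intro!: Rats_sum Rats_mult Rats_prod Rats_of_int)

text \<open>By Cramer's rule and \<open>det h = 1\<close>, the entries of the inverse are
  determinants of integer matrices.\<close>

lemma SLZ_right_inverse:
  assumes "h \<in> SLZ"
  obtains h' where "h' \<in> SLZ" "h ** h' = mat 1"
proof -
  have det: "det h = 1" using assms by (simp add: SLZ_def SL_def)
  then obtain h' where h': "h ** h' = mat 1"
    using invertible_det_nz[of h] by (auto simp: invertible_def)
  have "h' $ i $ j \<in> \<int>" for i j
  proof -
    have "h *v column j h' = axis j 1"
      unfolding matrix_vector_mult_basis[symmetric] by (simp add: matrix_vector_mul_assoc h')
    then have "column j h' = (\<chi> k. det (\<chi> a b. if b = k then axis j 1 $ a else h $ a $ b) / det h)"
      by (subst (asm) cramer) (simp_all add: det)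
    then have "h' $ i $ j = det (\<chi> a b. if b = i then axis j 1 $ a else h $ a $ b)"
      by (simp add: column_def vec_eq_iff det)
    also have "\<dots> \<in> \<int>" using assms by (intro det_Ints) (auto simp: axis_def SLZ_def)
    finally show ?thesis .
  qed
  moreover have "det h' = 1" using arg_cong[OF h', of det] det by (simp add: det_mul)
  ultimately show ?thesis using that[of h'] h' by (simp add: SLZ_def SL_def)
qed

text \<open>Closure of \<open>SLZ\<close> under products gives one inclusion; the same inclusion
  applied to the inverse of \<open>h\<close> gives the other.\<close>

lemma coset_mult_SLZ:
  assumes "h \<in> SLZ"
  shows "coset (g ** h) = coset g"
proof -
  obtain h' where h': "h' \<in> SLZ" "h ** h' = mat 1" using SLZ_right_inverse[OF assms] .
  have sub: "coset (g ** k) \<subseteq> coset g" if "k \<in> SLZ" for g k :: "real ^ 'n ^ 'n"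
    using that by (auto simp: coset_def matrix_mul_assoc[symmetric] intro: SLZ_mult)
  have "coset g = coset (g ** h ** h')"
    by (simp add: h'(2) matrix_mul_assoc[symmetric])
  then show ?thesis using sub[OF assms, of g] sub[OF h'(1), of "g ** h"] by auto
qed

lemma coset_eqD:
  assumes "coset g = coset g'"
  obtains h where "h \<in> SLZ" "g = g' ** h"
proof -
  have "g \<in> coset g" using mat_1_SLZ by (force simp: coset_def)
  then show ?thesis using assms that by (auto simp: coset_def)
qed

text \<open>The images of the expanding sets form an increasing open cover, so \<open>M\<close> lies
  in a single one. Representatives of a coset differ by an element of \<open>SLZ\<close>, which maps
  nonzero integer vectors to nonzero integer vectors, and these have norm at least 1.\<close>

lemma compactin_homog_short_vectors:
  fixes M :: "(real ^ 'n ^ 'n) set set"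
  assumes "compactin homog_topology M"
  obtains \<epsilon> where "\<epsilon> > 0" "\<And>g v. coset g \<in> M \<Longrightarrow> integer_vec v \<Longrightarrow> v \<noteq> 0 \<Longrightarrow> norm (g *v v) \<ge> \<epsilon>"
proof -
  define U :: "nat \<Rightarrow> (real ^ 'n ^ 'n) set set" where "U k = coset ` expanding (inverse (real (Suc k)))" for k
  have mono: "U j \<subseteq> U k" if "j \<le> k" for j k
    using that unfolding U_def by (intro image_mono expanding_antimono) (auto simp: field_simps)
  have opn: "openin homog_topology (U k)" for k
  proof -
    let ?E = "expanding (inverse (real (Suc k))) :: (real ^ 'n ^ 'n) set"
    \<comment> \<open>The preimage of \<open>U k\<close> is the saturation of the expanding set
      under \<open>SLZ\<close>, a union of right translates, each of which is open.\<close>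
    have eq: "{g \<in> SL. coset g \<in> U k} = (\<Union>h\<in>SLZ. {g \<in> SL. g ** h \<in> ?E})"
    proof (intro equalityI subsetI)
      fix g assume "g \<in> {g \<in> SL. coset g \<in> U k}"
      then obtain g' where g': "g \<in> SL" "g' \<in> ?E" "coset g' = coset g" by (auto simp: U_def)
      then show "g \<in> (\<Union>h\<in>SLZ. {g \<in> SL. g ** h \<in> ?E})" by (auto elim: coset_eqD)
    next
      fix g assume "g \<in> (\<Union>h\<in>SLZ. {g \<in> SL. g ** h \<in> ?E})"
      then obtain h where h: "h \<in> SLZ" "g \<in> SL" "g ** h \<in> ?E" by auto
      then show "g \<in> {g \<in> SL. coset g \<in> U k}"
        using h(2) imageI[OF h(3), of coset] coset_mult_SLZ[OF h(1), of g] by (simp add: U_def)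
    qed
    obtain T where T: "open T" "?E = SL \<inter> T"
      using openin_expanding by (auto simp: openin_open)
    have "{g \<in> SL. g ** h \<in> ?E} = SL \<inter> (\<lambda>g. g ** h) -` T" if "h \<in> SLZ" for h
      using that SL_mult unfolding T(2) by (auto simp: SLZ_def)
    moreover have "open ((\<lambda>g. g ** h) -` T)" for h :: "real ^ 'n ^ 'n"
      using T(1) by (intro open_vimage) (auto simp: matrix_matrix_mult_def intro!: continuous_intros)
    ultimately have "openin (top_of_set SL) {g \<in> SL. coset g \<in> U k}"
      unfolding eq by (intro openin_Union) auto
    moreover have "U k \<subseteq> homog" by (auto simp: U_def homog_def expanding_def)
    ultimately show ?thesis by (simp add: openin_homog_topology)
  qed
  have cover: "M \<subseteq> \<Union>(range U)"
  proof
    fix y assume "y \<in> M"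
    then obtain g where g: "g \<in> SL" "y = coset g"
      using compactin_subset_topspace[OF assms] by (auto simp: homog_def)
    obtain k where "g \<in> expanding (inverse (real (Suc k)))" using mem_expanding[OF g(1)] .
    then show "y \<in> \<Union>(range U)" unfolding U_def g(2) by blast
  qed
  have "\<exists>F. finite F \<and> F \<subseteq> range U \<and> M \<subseteq> \<Union>F"
    by (rule compactinD[OF assms _ cover]) (use opn in blast)
  then obtain F where F: "finite F" "F \<subseteq> range U" "M \<subseteq> \<Union>F" by blast
  from finite_subset_image[OF F(1,2)] obtain J where J: "finite J" "F = U ` J" by blast
  obtain k where "\<forall>j\<in>J. j \<le> k" using J(1) unfolding finite_nat_set_iff_bounded_le by blast
  then have k: "M \<subseteq> U k" using F(3) J(2) mono by blast
  show ?thesis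
  proof (rule that)
    fix g :: "real ^ 'n ^ 'n" and v :: "real ^ 'n"
    assume "coset g \<in> M" and v: "integer_vec v" "v \<noteq> 0"
    then obtain g' where g': "g' \<in> expanding (inverse (real (Suc k)))" "coset g = coset g'"
      using k by (auto simp: U_def)
    from g'(2) obtain h where h: "h \<in> SLZ" "g = g' ** h" by (rule coset_eqD)
    have "integer_vec (h *v v)" "h *v v \<noteq> 0"
      using h v by (auto simp: SLZ_integer_vec SL_mult_vec_nonzero SLZ_def)
    then have "1 \<le> norm (h *v v)" by (rule norm_integer_vec_ge_1)
    then have "inverse (real (Suc k)) * 1 \<le> inverse (real (Suc k)) * norm (h *v v)"
      by (intro mult_left_mono) auto
    also have "\<dots> \<le> norm (g' *v (h *v v))" by (rule expanding_norm_ge[OF g'(1)])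
    also have "g' *v (h *v v) = g *v v" by (simp add: h(2) matrix_vector_mul_assoc)
    finally show "inverse (real (Suc k)) \<le> norm (g *v v)" by simp
  qed auto
qed

section \<open>Rational matrices and the dominating sequence\<close>

definition SLQ :: "(real ^ 'n ^ 'n) set" where
  "SLQ = {A \<in> SL. \<forall>i j. A $ i $ j \<in> \<rat>}"

lemma SLQ_subset_SL: "SLQ \<subseteq> SL"
  by (auto simp: SLQ_def)

lemma SLQ_mult: "g \<in> SLQ \<Longrightarrow> h \<in> SLQ \<Longrightarrow> g ** h \<in> SLQ"
  unfolding SLQ_def using SL_mult[of g h]
  by (auto simp: matrix_matrix_mult_def intro!: Rats_sum Rats_mult)

lemma mat_1_SLQ: "mat 1 \<in> SLQ"
  by (auto simp: SLQ_def SL_def) (simp add: mat_def)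

lemma countable_SLQ: "countable (SLQ :: (real ^ 'n ^ 'n) set)"
proof -
  have "countable (range (\<lambda>f :: 'n \<Rightarrow> 'n \<Rightarrow> rat. (\<chi> i j. of_rat (f i j)) :: real ^ 'n ^ 'n))"
    by simp
  moreover have "SLQ \<subseteq> range (\<lambda>f :: 'n \<Rightarrow> 'n \<Rightarrow> rat. (\<chi> i j. of_rat (f i j)) :: real ^ 'n ^ 'n)"
  proof
    fix A :: "real ^ 'n ^ 'n" assume "A \<in> SLQ"
    then have "\<forall>i j. \<exists>q. A $ i $ j = of_rat q" by (auto simp: SLQ_def Rats_def)
    then obtain f where "\<And>i j. A $ i $ j = of_rat (f i j)" by metis
    then have "A = (\<chi> i j. of_rat (f i j))" by (simp add: vec_eq_iff)
    then show "A \<in> range (\<lambda>f :: 'n \<Rightarrow> 'n \<Rightarrow> rat. (\<chi> i j. of_rat (f i j)) :: real ^ 'n ^ 'n)" by blast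
  qed
  ultimately show ?thesis by (rule countable_subset[rotated])
qed

lemma tendsto_det:
  fixes A :: "'a \<Rightarrow> real ^ 'n ^ 'n"
  assumes "(A \<longlongrightarrow> B) F"
  shows "((\<lambda>x. det (A x)) \<longlongrightarrow> det B) F"
  unfolding det_def by (intro tendsto_intros assms)

text \<open>A rational matrix near \<open>A\<close> has determinant near 1, so dividing one of its rows by the
  determinant moves it only slightly.\<close>

lemma SL_subset_closure_SLQ: "SL \<subseteq> closure (SLQ :: (real ^ 'n ^ 'n) set)"
proof
  fix A :: "real ^ 'n ^ 'n" assume "A \<in> SL"
  then have A: "det A = 1" by (simp add: SL_def)
  \<comment> \<open>Any row may be chosen; rescaling exactly one row divides the determinant by
    \<open>det (R m)\<close> exactly once.\<close>
  obtain i0 :: 'n where True by simp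
  have "\<exists>q. (\<forall>m. q m \<in> \<rat>) \<and> q \<longlonglongrightarrow> A $ i $ j" for i j
  proof -
    have "\<exists>r\<in>\<rat>. \<bar>r - A $ i $ j\<bar> < inverse (real (Suc m))" for m
      using rational_approximation[of "inverse (real (Suc m))" "A $ i $ j"]
      by (metis inverse_positive_iff_positive of_nat_0_less_iff zero_less_Suc)
    then obtain q where q: "\<And>m. q m \<in> \<rat>" "\<And>m. \<bar>q m - A $ i $ j\<bar> < inverse (real (Suc m))" by metis
    have "(\<lambda>m. q m - A $ i $ j) \<longlonglongrightarrow> 0"
      by (rule Lim_null_comparison[OF _ LIMSEQ_inverse_real_of_nat])
         (use q(2) less_imp_le in \<open>auto simp: intro!: always_eventually\<close>)
    then have "q \<longlonglongrightarrow> A $ i $ j" by (rule LIM_zero_cancel)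
    then show ?thesis using q(1) by blast
  qed
  then obtain q where q: "\<And>i j m. q i j m \<in> \<rat>" "\<And>i j. q i j \<longlonglongrightarrow> A $ i $ j" by metis
  define R :: "nat \<Rightarrow> real ^ 'n ^ 'n" where "R m = (\<chi> i j. q i j m)" for m
  have R: "R \<longlonglongrightarrow> A"
    unfolding R_def by (intro vec_tendstoI) (simp add: q)
  then have det: "(\<lambda>m. det (R m)) \<longlonglongrightarrow> 1" using tendsto_det[OF R] A by simp
  define B :: "nat \<Rightarrow> real ^ 'n ^ 'n" where
    "B m = (\<chi> i. if i = i0 then inverse (det (R m)) *s (R m $ i) else R m $ i)" for m
  have "B \<longlonglongrightarrow> A"
  proof (intro vec_tendstoI)
    fix i j
    have "(\<lambda>m. inverse (det (R m)) * R m $ i $ j) \<longlonglongrightarrow> inverse 1 * A $ i $ j"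
      by (intro tendsto_intros det R) simp
    moreover have "(\<lambda>m. R m $ i $ j) \<longlonglongrightarrow> A $ i $ j" by (intro tendsto_intros R)
    ultimately show "(\<lambda>m. B m $ i $ j) \<longlonglongrightarrow> A $ i $ j"
      by (cases "i = i0") (simp_all add: B_def)
  qed
  moreover have "\<forall>\<^sub>F m in sequentially. B m \<in> SLQ"
  proof -
    have "\<forall>\<^sub>F m in sequentially. det (R m) \<noteq> 0"
      using tendsto_imp_eventually_ne[OF det] by simp
    then show ?thesis
    proof eventually_elim
      case (elim m)
      have "det (B m) = inverse (det (R m)) * det (\<chi> i. if i = i0 then R m $ i else R m $ i)"
        unfolding B_def by (rule det_row_mul)
      also have "\<dots> = 1" using elim by (simp add: if_cancel)
      finally have "det (B m) = 1" .
      moreover have "B m $ i $ j \<in> \<rat>" for i j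
        using q(1) by (auto simp: B_def R_def intro!: Rats_mult Rats_inverse det_Rats)
      ultimately show ?case by (simp add: SLQ_def SL_def)
    qed
  qed
  ultimately show "A \<in> closure SLQ"
    using Lim_in_closed_set[of "closure SLQ" B sequentially A] closure_subset
    by (metis (mono_tags, lifting) closed_closure eventually_mono subsetD trivial_limit_sequentially)
qed

section \<open>Contraction of a coordinate axis\<close>

lemma common_denominator:
  assumes "finite A" "\<And>i. i \<in> A \<Longrightarrow> f i \<in> (\<rat> :: real set)"
  obtains N :: nat where "N > 0" "\<And>i. i \<in> A \<Longrightarrow> real N * f i \<in> \<int>"
proof -
  have "\<exists>d :: nat. d > 0 \<and> real d * f i \<in> \<int>" if "i \<in> A" for i
  proof -
    from assms(2)[OF that] obtain a b :: int where "b > 0" "f i = of_int a / of_int b"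
      by (rule Rats_cases')
    then have "real (nat b) * f i = of_int a" by simp
    then show ?thesis using \<open>b > 0\<close> by (intro exI[of _ "nat b"]) auto
  qed
  then obtain d :: "'a \<Rightarrow> nat" where d: "\<And>i. i \<in> A \<Longrightarrow> d i > 0 \<and> real (d i) * f i \<in> \<int>" by metis
  show ?thesis
  proof (rule that[of "prod d A"])
    show "prod d A > 0" using d by (intro prod_pos) auto
    fix i assume i: "i \<in> A"
    have "real (prod d A) * f i = real (prod d (A - {i})) * (real (d i) * f i)"
      using i assms(1) by (simp add: prod.remove)
    also have "\<dots> \<in> \<int>" using d[OF i] by (simp add: Ints_mult del: of_nat_prod)
    finally show "real (prod d A) * f i \<in> \<int>" .
  qed
qed

text \<open>The preimage of the basis vector under \<open>B\<close> is rational by Cramer's rule;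
  multiplying by a common denominator \<open>N\<close> makes it integral.\<close>

lemma SLQ_axis_multiple:
  fixes B :: "real ^ 'n ^ 'n"
  assumes "B \<in> SLQ"
  obtains v and N :: nat where "integer_vec v" "v \<noteq> 0" "B *v v = real N *\<^sub>R axis i0 1"
proof -
  have det: "det B = 1" using assms by (simp add: SLQ_def SL_def)
  define u :: "real ^ 'n" where "u = (\<chi> k. det (\<chi> a b. if b = k then axis i0 1 $ a else B $ a $ b) / det B)"
  have u: "B *v u = axis i0 1" using cramer[of B u] det u_def by simp
  have "u $ k \<in> \<rat>" for k
    using assms unfolding u_def det vec_lambda_beta div_by_1
    by (intro det_Rats) (auto simp: axis_def SLQ_def)
  then obtain N :: nat where N: "N > 0" "\<And>k. real N * u $ k \<in> \<int>"
    using common_denominator[of UNIV "\<lambda>k. u $ k"] by auto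
  show ?thesis
  proof (rule that)
    show "integer_vec (real N *\<^sub>R u)" using N by (simp add: integer_vec_def)
    show "B *v (real N *\<^sub>R u) = real N *\<^sub>R axis i0 1" by (simp add: matrix_vector_mult_scaleR u)
    have "u \<noteq> 0" using u by (metis axis_eq_0_iff matrix_vector_mult_0_right zero_neq_one)
    then show "real N *\<^sub>R u \<noteq> 0" using N(1) by simp
  qed
qed

text \<open>For \<open>g\<close> in \<open>SL\<close> this bounds the length of a shortest nonzero
  vector of the lattice spanned by the columns of \<open>g\<close>.\<close>

definition short_vector :: "real \<Rightarrow> real ^ 'n ^ 'n \<Rightarrow> bool" where
  "short_vector \<epsilon> g \<longleftrightarrow> (\<exists>v. integer_vec v \<and> v \<noteq> 0 \<and> norm (g *v v) \<le> \<epsilon>)"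

text \<open>Since every \<open>B \<in> W\<close> is rational, \<open>B \<int>\<^sup>d\<close> contains a multiple of one fixed basis vector,
  so a diagonal matrix contracting that vector serves all of them.\<close>

lemma contracting_matrix:
  fixes W :: "(real ^ 'n ^ 'n) set"
  assumes "finite W" "W \<subseteq> SLQ" "CARD('n) \<ge> 2" "\<epsilon> > 0"
  obtains g where "g \<in> SLQ" "\<And>A B. A \<in> W \<Longrightarrow> B \<in> W \<Longrightarrow> short_vector \<epsilon> (A ** g ** B)"
proof -
  obtain i0 i1 :: 'n where i: "i0 \<noteq> i1"
    using assms(3) by (metis card_2_iff' card_le_Suc0_iff_eq finite_class.finite_UNIV iso_tuple_UNIV_I not_less_eq_eq numeral_2_eq_2)
  have "\<forall>B\<in>W. \<exists>v N. integer_vec v \<and> v \<noteq> 0 \<and> B *v v = real N *\<^sub>R axis i0 1"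
    using assms(2) by (meson SLQ_axis_multiple subsetD)
  then obtain v N where v: "\<And>B. B \<in> W \<Longrightarrow> integer_vec (v B) \<and> v B \<noteq> 0 \<and> B *v v B = real (N B) *\<^sub>R axis i0 1"
    by metis
  \<comment> \<open>A sum of nonnegative terms bounds each term, so \<open>C\<close> dominates
    \<open>norm A * real (N B)\<close> for all pairs in \<open>W\<close> at once. Contraction by
    \<open>1 / real m\<close> with \<open>m > C / \<epsilon>\<close> then suffices.\<close>
  define C where "C = (\<Sum>A\<in>W. norm A) * (\<Sum>B\<in>W. real (N B))"
  obtain m :: nat where m: "m > C / \<epsilon>" using reals_Archimedean2 by blast
  have C: "C \<ge> 0" by (auto simp: C_def intro!: mult_nonneg_nonneg sum_nonneg)
  then have "m > 0" using m assms(4) by (metis divide_nonneg_pos gr0I not_less of_nat_0)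
  \<comment> \<open>The entry \<open>real m\<close> on the second axis restores determinant 1; this
    is where dimension at least 2 enters.\<close>
  define d where "d = (\<lambda>i. if i = i0 then 1 / real m else if i = i1 then real m else 1)"
  define g :: "real ^ 'n ^ 'n" where "g = (\<chi> i j. if i = j then d i else 0)"
  have "det g = (\<Prod>i\<in>UNIV. d i)" by (subst det_diagonal) (auto simp: g_def)
  also have "\<dots> = d i0 * (d i1 * (\<Prod>i\<in>UNIV - {i0} - {i1}. d i))"
    using i by (simp add: prod.remove[of _ i0] prod.remove[of _ i1])
  also have "(\<Prod>i\<in>UNIV - {i0} - {i1}. d i) = 1" by (intro prod.neutral) (auto simp: d_def)
  finally have "det g = 1" using i \<open>m > 0\<close> by (simp add: d_def)
  then have "g \<in> SLQ" by (auto simp: SLQ_def SL_def g_def d_def)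
  moreover have "short_vector \<epsilon> (A ** g ** B)" if AB: "A \<in> W" "B \<in> W" for A B
  proof -
    have ax: "g *v axis i0 1 = (1 / real m) *\<^sub>R axis i0 1"
      unfolding matrix_vector_mult_basis by (auto simp: g_def vec_eq_iff column_def axis_def d_def)
    have "(A ** g ** B) *v v B = A *v (g *v (B *v v B))"
      by (simp add: matrix_vector_mul_assoc matrix_mul_assoc)
    also have "\<dots> = (real (N B) / real m) *\<^sub>R (A *v axis i0 1)"
      using v[OF AB(2)] by (simp add: matrix_vector_mult_scaleR ax)
    also have "norm \<dots> = (real (N B) / real m) * norm (A *v axis i0 1)" by simp
    also have "\<dots> \<le> (real (N B) / real m) * norm A"
      using norm_matrix_vector_mult_le[of A "axis i0 1"] by (intro mult_left_mono) auto
    also have "\<dots> = norm A * real (N B) / real m" by simp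
    also have "\<dots> \<le> C / real m"
      unfolding C_def using AB assms(1)
      by (intro divide_right_mono mult_mono member_le_sum sum_nonneg) auto
    also have "\<dots> \<le> \<epsilon>" using m \<open>m > 0\<close> assms(4) by (simp add: field_simps)
    finally show ?thesis using v[OF AB(2)] unfolding short_vector_def by blast
  qed
  ultimately show ?thesis using that by blast
qed

section \<open>Words and the recursive choice of the matrices\<close>

definition mprod :: "(real ^ 'n ^ 'n) list \<Rightarrow> real ^ 'n ^ 'n" where
  "mprod l = foldr (**) l (mat 1)"

lemma mprod_simps [simp]: "mprod [] = mat 1" "mprod (g # l) = g ** mprod l"
  by (simp_all add: mprod_def)

lemma mprod_append [simp]: "mprod (l @ l') = mprod l ** mprod l'"
  by (induction l) (simp_all add: matrix_mul_assoc)

lemma rprod_eq_mprod: "rprod \<gamma> n = mprod (map \<gamma> [0..<n])"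
  by (induction n) simp_all

lemma lprod_eq_mprod: "lprod \<gamma> n = mprod (rev (map \<gamma> [0..<n]))"
  by (induction n) simp_all

lemma mprod_SLQ: "set l \<subseteq> SLQ \<Longrightarrow> mprod l \<in> SLQ"
  by (induction l) (auto simp: mat_1_SLQ SLQ_mult)

text \<open>The length bound keeps the set finite for finite \<open>F\<close>. The empty word is
  included because the dominating step may be the first or the last one.\<close>

definition words :: "nat \<Rightarrow> (real ^ 'n ^ 'n) set \<Rightarrow> (real ^ 'n ^ 'n) set" where
  "words c F = mprod ` {l. set l \<subseteq> F \<and> length l \<le> c}"

text \<open>The squares are the indices at which \<open>b\<close> is enumerated; there are so few of them that almost
  surely only finitely many are record values of the index sequence.\<close>

lemma dominating_sequence:
  fixes b :: "nat \<Rightarrow> real ^ 'n ^ 'n" and c :: "nat \<Rightarrow> nat"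
  assumes "CARD('n) \<ge> 2" "range b \<subseteq> SLQ"
  obtains G where "\<And>k. G k \<in> SLQ" "\<And>j. G (j\<^sup>2) = b j"
    "\<And>k A B. k \<notin> range power2 \<Longrightarrow> A \<in> words (c k) (G ` {..<k}) \<Longrightarrow> B \<in> words (c k) (G ` {..<k})
       \<Longrightarrow> short_vector (1 / real (Suc (c k))) (A ** G k ** B)"
proof -
  define P :: "(nat \<Rightarrow> real ^ 'n ^ 'n) \<Rightarrow> nat \<Rightarrow> real ^ 'n ^ 'n \<Rightarrow> bool" where
    "P G k g \<longleftrightarrow> g \<in> SLQ \<and> (\<forall>j. k = j\<^sup>2 \<longrightarrow> g = b j) \<and>
       (k \<notin> range power2 \<longrightarrow> (\<forall>A \<in> words (c k) (G ` {..<k}). \<forall>B \<in> words (c k) (G ` {..<k}).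
          short_vector (1 / real (Suc (c k))) (A ** g ** B)))" for G k g
  have "\<exists>G. \<forall>k. P G k (G k)"
  \<comment> \<open>Recursive choice along \<open><\<close>: the condition at \<open>k\<close>
    depends on \<open>G\<close> only through its values below \<open>k\<close>.\<close>
  proof (rule dependent_wf_choice[OF wf_less])
    fix G G' :: "nat \<Rightarrow> real ^ 'n ^ 'n" and k g
    assume "\<And>j. (j, k) \<in> {(x, y). x < y} \<Longrightarrow> G j = G' j"
    then have "G ` {..<k} = G' ` {..<k}" by (intro image_cong) auto
    then show "P G k g = P G' k g" unfolding P_def by simp
  next
    fix k and G :: "nat \<Rightarrow> real ^ 'n ^ 'n"
    assume IH: "\<And>j. (j, k) \<in> {(x, y). x < y} \<Longrightarrow> P G j (G j)"
    show "\<exists>g. P G k g"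
    proof (cases "k \<in> range power2")
      case True
      then obtain j where "k = j\<^sup>2" by blast
      \<comment> \<open>A natural number has at most one square root, so the prescribed value is
        unambiguous.\<close>
      then have "P G k (b j)" using assms(2) by (auto simp: P_def)
      then show ?thesis by blast
    next
      case False
      let ?W = "words (c k) (G ` {..<k})"
      have "finite ?W" unfolding words_def by (intro finite_imageI finite_lists_length_le) auto
      moreover have "?W \<subseteq> SLQ"
        unfolding words_def using IH by (auto intro!: mprod_SLQ simp: P_def)
      ultimately obtain g where "g \<in> SLQ"
          "\<And>A B. A \<in> ?W \<Longrightarrow> B \<in> ?W \<Longrightarrow> short_vector (1 / real (Suc (c k))) (A ** g ** B)"
        using contracting_matrix[OF _ _ assms(1), of ?W "1 / real (Suc (c k))"] by auto
      then have "P G k g" using False by (auto simp: P_def)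
      then show ?thesis by blast
    qed
  qed
  then obtain G where G: "\<And>k. P G k (G k)" by blast
  show ?thesis
  proof (rule that[of G])
    show "G k \<in> SLQ" for k using G[of k] by (simp add: P_def)
    show "G (j\<^sup>2) = b j" for j using G[of "j\<^sup>2"] by (simp add: P_def)
    show "short_vector (1 / real (Suc (c k))) (A ** G k ** B)"
      if "k \<notin> range power2" "A \<in> words (c k) (G ` {..<k})" "B \<in> words (c k) (G ` {..<k})" for k A B
      using G[of k] that by (auto simp: P_def)
  qed
qed

section \<open>Record values of a heavy-tailed sequence\<close>

text \<open>The weights are the differences \<open>1 / (k + 1) - 1 / (k + 2)\<close>, so they
  telescope to total mass 1.\<close>

definition rec_pmf :: "nat pmf" where
  "rec_pmf = embed_pmf (\<lambda>k. 1 / (real (k + 1) * real (k + 2)))"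

lemma pmf_rec_pmf: "pmf rec_pmf k = 1 / (real (k + 1) * real (k + 2))"
proof -
  have "(\<lambda>k. inverse (real (Suc k)) - inverse (real (Suc (Suc k)))) sums (inverse (real (Suc 0)) - 0)"
    using telescope_sums'[OF LIMSEQ_inverse_real_of_nat] by simp
  then have "(\<lambda>k. 1 / (real (k + 1) * real (k + 2))) sums 1"
    by (simp add: field_simps)
  then have "(\<Sum>k. ennreal (1 / (real (k + 1) * real (k + 2)))) = 1"
    by (subst suminf_ennreal_eq) auto
  then have "(\<integral>\<^sup>+ k. ennreal (1 / (real (k + 1) * real (k + 2))) \<partial>count_space UNIV) = 1"
    by (simp add: nn_integral_count_space_nat)
  then show ?thesis unfolding rec_pmf_def by (subst pmf_embed_pmf) auto
qed

lemma measure_rec_pmf_lessThan: "measure rec_pmf {..<k} = real k / real (k + 1)"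
proof -
  have "measure rec_pmf {..<k} = (\<Sum>j<k. 1 / (real (j + 1) * real (j + 2)))"
    by (simp add: measure_measure_pmf_finite pmf_rec_pmf)
  also have "\<dots> = real k / real (k + 1)"
  proof (induction k)
    case (Suc k)
    have "a / (a + 1) + 1 / ((a + 1) * (a + 2)) = (a + 1) / (a + 2)" if "a \<ge> 0" for a :: real
      using that by (simp add: divide_simps) (simp add: algebra_simps)
    from this[of "real k"] show ?case using Suc by (simp add: add_ac)
  qed simp
  finally show ?thesis .
qed

lemma measure_rec_pmf_singleton: "measure rec_pmf {k} = 1 / (real (k + 1) * real (k + 2))"
  by (simp add: measure_pmf_single pmf_rec_pmf)

abbreviation rec_space :: "(nat \<Rightarrow> nat) measure" where
  "rec_space \<equiv> \<Pi>\<^sub>M i\<in>(UNIV :: nat set). measure_pmf rec_pmf"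

interpretation rec: sequence_space "measure_pmf rec_pmf"
  by unfold_locales

lemma space_rec_space [simp]: "space rec_space = UNIV"
  by (auto simp: space_PiM)

lemma sets_rec_cylinder:
  assumes "finite J"
  shows "{\<omega>. \<forall>i\<in>J. \<omega> i \<in> X i} \<in> sets rec_space"
proof -
  have "{\<omega> \<in> space rec_space. \<forall>i\<in>J. \<omega> i \<in> X i} \<in> sets rec_space"
    using assms by measurable
  then show ?thesis by simp
qed

lemma measure_rec_cylinder:
  assumes "finite J"
  shows "measure rec_space {\<omega>. \<forall>i\<in>J. \<omega> i \<in> X i} = (\<Prod>i\<in>J. measure rec_pmf (X i))"
proof -
  have "emeasure rec_space {\<omega> \<in> space rec_space. \<forall>i\<in>J. \<omega> i \<in> X i} = (\<Prod>i\<in>J. emeasure rec_pmf (X i))"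
    using assms by (intro rec.emeasure_PiM_Collect) auto
  then have "emeasure rec_space {\<omega>. \<forall>i\<in>J. \<omega> i \<in> X i} = ennreal (\<Prod>i\<in>J. measure rec_pmf (X i))"
    by (simp add: measure_pmf.emeasure_eq_measure prod_ennreal)
  then show ?thesis by (simp add: measure_def prod_nonneg)
qed

text \<open>Countable subadditivity and the geometric series. In the applications the union runs
  over waiting times, and \<open>r\<close> is the probability that one index stays below the level
  \<open>k\<close>.\<close>

lemma measure_UN_le_geometric:
  assumes "finite_measure M" "\<And>m. A m \<in> sets M" "\<And>m. measure M (A m) \<le> C * r ^ m" "0 \<le> r" "r < 1"
  shows "measure M (\<Union>m. A m) \<le> C / (1 - r)"
proof -
  interpret finite_measure M by fact
  have s: "(\<lambda>m. C * r ^ m) sums (C / (1 - r))"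
    using sums_mult[OF geometric_sums[of r], of C] assms by simp
  have sm: "summable (\<lambda>m. measure M (A m))"
    using assms(3) by (intro summable_comparison_test'[OF sums_summable[OF s]]) auto
  have "measure M (\<Union>m. A m) \<le> (\<Sum>m. measure M (A m))"
    using assms(2) sm by (intro finite_measure_subadditive_countably) auto
  also have "\<dots> \<le> (\<Sum>m. C * r ^ m)"
    using assms(3) sm sums_summable[OF s] by (intro suminf_le) auto
  also have "\<dots> = C / (1 - r)" using s by (rule sums_unique[symmetric])
  finally show ?thesis .
qed

section \<open>Record, tie and slow events\<close>

definition record_event :: "nat \<Rightarrow> (nat \<Rightarrow> nat) set" where
  "record_event k = (\<Union>m. {\<omega>. \<omega> m = k \<and> (\<forall>i<m. \<omega> i < k)})"

text \<open>\<open>m\<close> and \<open>m + l + 1\<close> are the first two times at which the value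
  \<open>k\<close> occurs. Writing the gap as \<open>l + 1\<close> lets both parameters range freely
  over the naturals, which yields a double geometric series.\<close>

definition tie_event :: "nat \<Rightarrow> (nat \<Rightarrow> nat) set" where
  "tie_event k = (\<Union>m. \<Union>l. {\<omega>. \<omega> m = k \<and> \<omega> (m + l + 1) = k \<and> (\<forall>i<m + l + 1. i \<noteq> m \<longrightarrow> \<omega> i < k)})"

text \<open>The quadratic horizon makes the probability exponentially small in \<open>k\<close>, and
  it is the source of the bound on \<open>n\<close> in terms of the running maximum.\<close>

definition slow_event :: "nat \<Rightarrow> (nat \<Rightarrow> nat) set" where
  "slow_event k = {\<omega>. \<forall>i<(k + 1)\<^sup>2. \<omega> i < k}"

text \<open>Puts the event for a fixed time into the form of a finite cylinder, to which the product
  formula applies.\<close>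

lemma record_cylinder_eq:
  "{\<omega> :: nat \<Rightarrow> nat. \<omega> m = k \<and> (\<forall>i<m. \<omega> i < k)} =
   {\<omega>. \<forall>i\<in>{..m}. \<omega> i \<in> (if i = m then {k} else {..<k})}"
  unfolding ivl_disj_un_singleton(2)[symmetric] by auto

text \<open>The first index that is at least \<open>k\<close> must equal \<open>k\<close>. Summing
  over its time gives \<open>w / (1 - r)\<close>, where \<open>w\<close> is the mass of
  \<open>k\<close> and \<open>1 - r = 1 / (k + 1)\<close> is the tail from \<open>k\<close>
  on.\<close>

lemma record_event_bound:
  "record_event k \<in> sets rec_space" "measure rec_space (record_event k) \<le> 1 / real (k + 2)"
proof -
  let ?A = "\<lambda>m. {\<omega> :: nat \<Rightarrow> nat. \<omega> m = k \<and> (\<forall>i<m. \<omega> i < k)}"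
  have meas: "?A m \<in> sets rec_space" for m
    unfolding record_cylinder_eq by (rule sets_rec_cylinder) simp
  then show "record_event k \<in> sets rec_space"
    unfolding record_event_def by (intro sets.countable_UN'') auto
  have A: "measure rec_space (?A m) = 1 / (real (k + 1) * real (k + 2)) * (real k / real (k + 1)) ^ m" for m
  proof -
    have eq: "{..m} = insert m {..<m}" by auto
    have "measure rec_space (?A m) = (\<Prod>i\<in>insert m {..<m}. measure rec_pmf (if i = m then {k} else {..<k}))"
      unfolding record_cylinder_eq eq by (rule measure_rec_cylinder) simp
    also have "\<dots> = measure rec_pmf {k} * (\<Prod>i\<in>{..<m}. measure rec_pmf {..<k})"
      by (subst prod.insert) (simp_all cong: prod.cong_simp)
    finally show ?thesis by (simp only: measure_rec_pmf_singleton measure_rec_pmf_lessThan prod_constant card_lessThan)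
  qed
  have "measure rec_space (\<Union>m. ?A m) \<le> 1 / (real (k + 1) * real (k + 2)) / (1 - real k / real (k + 1))"
    by (rule measure_UN_le_geometric[OF rec.P.finite_measure_axioms meas eq_refl[OF A]]) simp_all
  also have "\<dots> = 1 / real (k + 2)"
  proof -
    have "1 - real k / real (k + 1) = 1 / real (k + 1)" by (simp add: field_simps)
    then show ?thesis by simp
  qed
  finally show "measure rec_space (record_event k) \<le> 1 / real (k + 2)" unfolding record_event_def .
qed

lemma tie_cylinder_eq:
  "{\<omega> :: nat \<Rightarrow> nat. \<omega> m = k \<and> \<omega> (m + l + 1) = k \<and> (\<forall>i<m + l + 1. i \<noteq> m \<longrightarrow> \<omega> i < k)} =
   {\<omega>. \<forall>i\<in>{..m + l + 1}. \<omega> i \<in> (if i = m \<or> i = m + l + 1 then {k} else {..<k})}"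
  unfolding ivl_disj_un_singleton(2)[symmetric] by auto

text \<open>As for records, but with two independent occurrences of \<open>k\<close>: the double
  geometric series is the square of the record bound.\<close>

lemma tie_event_bound:
  "tie_event k \<in> sets rec_space" "measure rec_space (tie_event k) \<le> (1 / real (k + 2))\<^sup>2"
proof -
  let ?A = "\<lambda>m l. {\<omega> :: nat \<Rightarrow> nat. \<omega> m = k \<and> \<omega> (m + l + 1) = k \<and> (\<forall>i<m + l + 1. i \<noteq> m \<longrightarrow> \<omega> i < k)}"
  define w where "w = 1 / (real (k + 1) * real (k + 2))"
  define r where "r = real k / real (k + 1)"
  have r: "0 \<le> r" "r < 1" by (auto simp: r_def)
  have meas: "?A m l \<in> sets rec_space" for m l
    unfolding tie_cylinder_eq by (rule sets_rec_cylinder) simp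
  then show "tie_event k \<in> sets rec_space"
    unfolding tie_event_def by (intro sets.countable_UN'') auto
  have A: "measure rec_space (?A m l) = w\<^sup>2 * r ^ m * r ^ l" for m l
  proof -
    let ?B = "{..<m + l + 1} - {m}"
    have eq: "{..m + l + 1} = insert m (insert (m + l + 1) ?B)" by auto
    have "measure rec_space (?A m l) = (\<Prod>i\<in>insert m (insert (m + l + 1) ?B).
        measure rec_pmf (if i = m \<or> i = m + l + 1 then {k} else {..<k}))"
      unfolding tie_cylinder_eq eq by (rule measure_rec_cylinder) simp
    also have "\<dots> = measure rec_pmf {k} * (measure rec_pmf {k} * (\<Prod>i\<in>?B. measure rec_pmf {..<k}))"
      by (subst prod.insert, simp, simp, subst prod.insert) (auto intro!: prod.cong)
    \<comment> \<open>Of the \<open>m + l + 2\<close> indices up to time \<open>m + l + 1\<close>,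
      two equal \<open>k\<close>; this leaves \<open>m + l\<close> below it.\<close>
    also have "(\<Prod>i\<in>?B. measure rec_pmf {..<k}) = measure rec_pmf {..<k} ^ (m + l)"
      by (simp add: card_Diff_subset)
    finally show ?thesis
      unfolding measure_rec_pmf_singleton measure_rec_pmf_lessThan w_def[symmetric] r_def[symmetric]
      by (simp add: power2_eq_square power_add mult_ac)
  qed
  have "measure rec_space (\<Union>l. ?A m l) \<le> w\<^sup>2 * r ^ m / (1 - r)" for m
    by (rule measure_UN_le_geometric[OF rec.P.finite_measure_axioms meas eq_refl[OF A] r])
  then have "measure rec_space (\<Union>l. ?A m l) \<le> w\<^sup>2 / (1 - r) * r ^ m" for m
    by (simp only: times_divide_eq_left)
  then have "measure rec_space (\<Union>m. \<Union>l. ?A m l) \<le> w\<^sup>2 / (1 - r) / (1 - r)"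
    by (intro measure_UN_le_geometric rec.P.finite_measure_axioms sets.countable_UN'' meas r) auto
  also have "\<dots> = (w / (1 - r))\<^sup>2" by (simp add: power2_eq_square)
  also have "w / (1 - r) = 1 / real (k + 2)"
  proof -
    have "1 - r = 1 / real (k + 1)" by (simp add: field_simps r_def)
    then show ?thesis by (simp add: w_def)
  qed
  finally show "measure rec_space (tie_event k) \<le> (1 / real (k + 2))\<^sup>2" unfolding tie_event_def .
qed

text \<open>From \<open>1 - t \<le> exp (- t)\<close> with \<open>t = 1 / (k + 1)\<close>, raised to
  the power \<open>(k + 1)\<^sup>2\<close>.\<close>

lemma slow_event_bound:
  "slow_event k \<in> sets rec_space" "measure rec_space (slow_event k) \<le> exp (- 1) ^ k"
proof -
  have eq: "slow_event k = {\<omega>. \<forall>i\<in>{..<(k + 1)\<^sup>2}. \<omega> i \<in> {..<k}}" by (auto simp: slow_event_def)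
  show "slow_event k \<in> sets rec_space" unfolding eq by (rule sets_rec_cylinder) simp
  have "measure rec_space (slow_event k) = (real k / real (k + 1)) ^ ((k + 1)\<^sup>2)"
    unfolding eq by (subst measure_rec_cylinder) (simp_all only: measure_rec_pmf_lessThan prod_constant card_lessThan finite_lessThan)
  also have "\<dots> \<le> exp (- 1 / real (k + 1)) ^ ((k + 1)\<^sup>2)"
    using exp_ge_add_one_self[of "- 1 / real (k + 1)"] by (intro power_mono) (simp_all add: field_simps)
  also have "\<dots> = exp (real ((k + 1)\<^sup>2) * (- 1 / real (k + 1)))" by (rule exp_of_nat_mult[symmetric])
  also have "real ((k + 1)\<^sup>2) * (- 1 / real (k + 1)) = real (k + 1) * (- 1)"
    unfolding power2_eq_square of_nat_mult by simp
  also have "exp \<dots> = exp (- 1) ^ (k + 1)" by (rule exp_of_nat_mult)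
  also have "\<dots> \<le> exp (- 1) ^ k" by (rule power_decreasing) auto
  finally show "measure rec_space (slow_event k) \<le> exp (- 1) ^ k" .
qed

text \<open>The first Borel-Cantelli lemma, with a summable majorant.\<close>

lemma AE_rec_eventually_notin:
  assumes "\<And>k. A k \<in> sets rec_space" "\<And>k. measure rec_space (A k) \<le> f k" "summable f"
  shows "AE \<omega> in rec_space. \<forall>\<^sub>F k in sequentially. \<omega> \<notin> A k"
proof -
  have "summable (\<lambda>k. measure rec_space (A k))"
    using assms(2) by (intro summable_comparison_test'[OF assms(3), of 0]) simp
  moreover have "emeasure rec_space (A k) < \<infinity>" for k
    by (simp add: rec.P.emeasure_eq_measure)
  ultimately have "AE \<omega> in rec_space. \<forall>\<^sub>F k in sequentially. \<omega> \<in> space rec_space - A k"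
    by (intro borel_cantelli_AE1 assms(1))
  then show ?thesis by simp
qed

lemma AE_rec_dominated:
  "AE \<omega> in rec_space. \<forall>\<^sub>F n in sequentially. \<exists>m<n. \<omega> m \<notin> range power2 \<and> n \<le> (\<omega> m + 2)\<^sup>2 \<and>
     (\<forall>i<n. i \<noteq> m \<longrightarrow> \<omega> i < \<omega> m)"
proof -
  have sq: "summable (\<lambda>k. 1 / real (k + 2) ^ 2)"
  proof -
    have "summable (\<lambda>k. inverse (real (k + 2) ^ 2))"
      using inverse_power_summable[of 2, where 'a = real] by (subst summable_iff_shift) simp
    then show ?thesis by (simp only: inverse_eq_divide)
  qed
  \<comment> \<open>The record bound \<open>1 / (k + 2)\<close> is not summable over all levels
    \<open>k\<close>, but it is along the squares.\<close>
  have "summable (\<lambda>j. 1 / real (j\<^sup>2 + 2))"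
  proof (rule summable_comparison_test'[where N = 1])
    show "summable (\<lambda>j. inverse (real j ^ 2))" by (rule inverse_power_summable) simp
    show "norm (1 / real (j\<^sup>2 + 2)) \<le> inverse (real j ^ 2)" if "j \<ge> 1" for j
    proof -
      have "0 < real j" using that by simp
      then have "1 / (real j ^ 2 + 2) \<le> 1 / real j ^ 2"
        by (intro divide_left_mono mult_pos_pos) (auto intro: add_pos_pos)
      then show ?thesis unfolding inverse_eq_divide by (simp add: add.commute)
    qed
  qed
  from AE_rec_eventually_notin[OF record_event_bound this]
  have 1: "AE \<omega> in rec_space. \<forall>\<^sub>F j in sequentially. \<omega> \<notin> record_event (j\<^sup>2)" .
  from AE_rec_eventually_notin[OF tie_event_bound] sq
  have 2: "AE \<omega> in rec_space. \<forall>\<^sub>F k in sequentially. \<omega> \<notin> tie_event k"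
    by (simp add: power_one_over)
  have "summable (\<lambda>k. exp (- 1 :: real) ^ k)" by (rule summable_geometric) simp
  from AE_rec_eventually_notin[OF slow_event_bound this]
  have 3: "AE \<omega> in rec_space. \<forall>\<^sub>F k in sequentially. \<omega> \<notin> slow_event k" .
  from 1 2 3 show ?thesis
  proof eventually_elim
    case (elim \<omega>)
    from elim(1) obtain j0 where j0: "\<And>j. j \<ge> j0 \<Longrightarrow> \<omega> \<notin> record_event (j\<^sup>2)"
      unfolding eventually_sequentially by blast
    from elim(2) obtain k1 where k1: "\<And>k. k \<ge> k1 \<Longrightarrow> \<omega> \<notin> tie_event k"
      unfolding eventually_sequentially by blast
    from elim(3) obtain k2 where k2: "\<And>k. k \<ge> k2 \<Longrightarrow> \<omega> \<notin> slow_event k"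
      unfolding eventually_sequentially by blast
    \<comment> \<open>Taking \<open>K \<ge> j0\<^sup>2\<close> ensures that a square which is at
      least \<open>K\<close> has its root at least \<open>j0\<close>.\<close>
    define K where "K = Max {j0\<^sup>2, k1, k2}"
    have K: "K \<ge> j0\<^sup>2" "K \<ge> k1" "K \<ge> k2" by (auto simp: K_def)
    show ?case
      unfolding eventually_sequentially
    proof (rule exI[of _ "(K + 1)\<^sup>2"], intro allI impI)
      fix n assume n: "n \<ge> (K + 1)\<^sup>2"
      then have "n > 0" by (cases n) auto
      define M where "M = Max (\<omega> ` {..<n})"
      have M: "\<omega> i \<le> M" if "i < n" for i using that by (auto simp: M_def)
      have "M \<in> \<omega> ` {..<n}" unfolding M_def using \<open>n > 0\<close> by (intro Max_in) auto
      then have ex: "\<exists>m. m < n \<and> \<omega> m = M" by auto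
      \<comment> \<open>The horizon of this event lies within the first \<open>n\<close> steps, so
        the maximum \<open>M\<close> has already reached \<open>K\<close>.\<close>
      have "\<omega> \<notin> slow_event K" using k2 K(3) by blast
      then obtain i where "i < (K + 1)\<^sup>2" "\<omega> i \<ge> K" by (auto simp: slow_event_def not_less)
      then have MK: "M \<ge> K" using M[of i] n by linarith
      \<comment> \<open>Some index before time \<open>(M + 2)\<^sup>2\<close> exceeds
        \<open>M\<close>. It cannot be among the first \<open>n\<close>, hence the bound on
        \<open>n\<close>.\<close>
      have "\<omega> \<notin> slow_event (M + 1)" using k2[of "M + 1"] K(3) MK by auto
      then obtain i where "i < (M + 2)\<^sup>2" "\<omega> i \<ge> M + 1" by (auto simp: slow_event_def not_less)
      then have nM: "n \<le> (M + 2)\<^sup>2" using M[of i] by linarith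
      \<comment> \<open>The first time the maximum is attained, so that \<open>M\<close> is a strict
        record there.\<close>
      define m where "m = (LEAST m. m < n \<and> \<omega> m = M)"
      have m: "m < n" "\<omega> m = M" using LeastI_ex[OF ex] unfolding m_def by blast+
      have first: "\<omega> i < M" if "i < m" for i
        using not_less_Least[OF that[unfolded m_def]] that m(1) M[of i] by linarith
      have nsq: "M \<notin> range power2"
      proof
        assume "M \<in> range power2"
        then obtain j where j: "M = j\<^sup>2" by blast
        then have "j0\<^sup>2 \<le> j\<^sup>2" using K(1) MK by linarith
        then have "j \<ge> j0" by (simp add: power2_nat_le_eq_le)
        then have "\<omega> \<notin> record_event M" using j0 j by blast
        then show False using m(2) first by (auto simp: record_event_def)
      qed
      have "\<omega> i < M" if i: "i < n" "i \<noteq> m" for i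
      proof (rule ccontr)
        assume "\<not> \<omega> i < M"
        then have "\<omega> i = M" using M[OF i(1)] by simp
        then have "i > m" using first[of i] i(2) by (meson less_irrefl linorder_neqE_nat)
        then have ex': "\<exists>i. m < i \<and> i < n \<and> \<omega> i = M" using i \<open>\<omega> i = M\<close> by blast
        \<comment> \<open>The next time after \<open>m\<close> at which \<open>M\<close> is
          attained; by minimality, \<open>m\<close> and \<open>m'\<close> witness a tie.\<close>
        define m' where "m' = (LEAST i. m < i \<and> i < n \<and> \<omega> i = M)"
        have m': "m < m'" "m' < n" "\<omega> m' = M" using LeastI_ex[OF ex'] unfolding m'_def by blast+
        have "\<omega> i < M" if "i < m'" "i \<noteq> m" for i
        proof (cases "i < m")
          case False
          then show ?thesis
            using not_less_Least[OF that(1)[unfolded m'_def]] that m'(2) M[of i] by linarith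
        qed (rule first)
        moreover obtain l where "m' = m + l + 1" using m'(1) less_iff_Suc_add by auto
        ultimately have "\<omega> \<in> tie_event M"
          unfolding tie_event_def using m(2) m'(3) by blast
        then show False using k1[of M] K(2) MK by auto
      qed
      then show "\<exists>m<n. \<omega> m \<notin> range power2 \<and> n \<le> (\<omega> m + 2)\<^sup>2 \<and> (\<forall>i<n. i \<noteq> m \<longrightarrow> \<omega> i < \<omega> m)"
        using m nsq nM by (intro exI[of _ m]) auto
    qed
  qed
qed

section \<open>Products of independent matrices\<close>

text \<open>Dominated convergence for the indicator functions.\<close>

lemma measure_tendsto_0_if_AE_eventually_notin:
  assumes "finite_measure M" "\<And>n. A n \<in> sets M" "AE x in M. \<forall>\<^sub>F n in sequentially. x \<notin> A n"
  shows "(\<lambda>n. measure M (A n)) \<longlonglongrightarrow> 0"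
proof -
  interpret finite_measure M by fact
  have "(\<lambda>n. \<integral>x. indicator (A n) x \<partial>M) \<longlonglongrightarrow> (\<integral>x. 0 \<partial>M :: real)"
  proof (rule integral_dominated_convergence[where w = "\<lambda>_. 1"])
    show "AE x in M. (\<lambda>n. indicator (A n) x :: real) \<longlonglongrightarrow> 0"
      using assms(3)
    proof eventually_elim
      case (elim x)
      then have "\<forall>\<^sub>F n in sequentially. indicator (A n) x = (0 :: real)"
        by eventually_elim simp
      then show ?case by (rule tendsto_eventually)
    qed
  qed (use assms(2) in \<open>auto simp: indicator_def\<close>)
  then show ?thesis using assms(2) by (simp add: sets.Int_space_eq2)
qed

lemma measurable_map_sequence:
  assumes f: "f \<in> M \<rightarrow>\<^sub>M N"
  shows "(\<lambda>\<omega> i. f (\<omega> i)) \<in> (\<Pi>\<^sub>M i\<in>(UNIV :: nat set). M) \<rightarrow>\<^sub>M (\<Pi>\<^sub>M i\<in>(UNIV :: nat set). N)"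
proof (rule measurable_PiM_single')
  show "(\<lambda>\<omega>. f (\<omega> i)) \<in> (\<Pi>\<^sub>M i\<in>(UNIV :: nat set). M) \<rightarrow>\<^sub>M N" for i :: nat
    by (rule measurable_compose[OF _ f]) measurable
  show "(\<lambda>\<omega> i. f (\<omega> i)) \<in> space (\<Pi>\<^sub>M i\<in>(UNIV :: nat set). M) \<rightarrow> (\<Pi>\<^sub>E i\<in>(UNIV :: nat set). space N)"
    using measurable_space[OF f] by (auto simp: space_PiM PiE_iff)
qed

text \<open>A product measure is determined by finite cylinders, and a coordinatewise map pulls
  cylinders back to cylinders. This transfers almost sure statements from index sequences to matrix
  sequences.\<close>

lemma PiM_distr_sequence:
  assumes "prob_space M" and f: "f \<in> M \<rightarrow>\<^sub>M N"
  shows "(\<Pi>\<^sub>M i\<in>(UNIV :: nat set). distr M N f) =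
    distr (\<Pi>\<^sub>M i\<in>(UNIV :: nat set). M) (\<Pi>\<^sub>M i\<in>(UNIV :: nat set). N) (\<lambda>\<omega> i. f (\<omega> i))"
proof -
  interpret M: prob_space M by fact
  interpret D: prob_space "distr M N f" by (rule M.prob_space_distr[OF f])
  interpret MS: sequence_space M by unfold_locales
  interpret DS: sequence_space "distr M N f" by unfold_locales
  let ?S = "\<Pi>\<^sub>M i\<in>(UNIV :: nat set). M" and ?T = "\<Pi>\<^sub>M i\<in>(UNIV :: nat set). N"
  have meas: "(\<lambda>\<omega> i. f (\<omega> i)) \<in> ?S \<rightarrow>\<^sub>M ?T" by (rule measurable_map_sequence[OF f])
  have sets_T: "sets (\<Pi>\<^sub>M i\<in>(UNIV :: nat set). distr M N f) = sets ?T"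
    by (rule sets_PiM_cong) simp_all
  then have sets: "sets (distr ?S ?T (\<lambda>\<omega> i. f (\<omega> i))) = sets (\<Pi>\<^sub>M i\<in>(UNIV :: nat set). distr M N f)"
    by simp
  show ?thesis
  proof (rule DS.PiM_eq[OF sets, symmetric])
    fix J :: "nat set" and F assume J: "finite J" "\<And>j. j \<in> J \<Longrightarrow> F j \<in> sets (distr M N f)"
    let ?E = "prod_emb UNIV (\<lambda>_. distr M N f) J (Pi\<^sub>E J F)"
    have E: "?E \<in> sets ?T"
      unfolding sets_T[symmetric] using J by (intro sets_PiM_I) auto
    have "(\<lambda>\<omega> i. f (\<omega> i)) -` ?E \<inter> space ?S = {\<omega> \<in> space ?S. \<forall>j\<in>J. \<omega> j \<in> f -` F j \<inter> space M}"
      using measurable_space[OF f] by (auto simp: prod_emb_def space_PiM PiE_iff)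
    then have "emeasure (distr ?S ?T (\<lambda>\<omega> i. f (\<omega> i))) ?E =
        emeasure ?S {\<omega> \<in> space ?S. \<forall>j\<in>J. \<omega> j \<in> f -` F j \<inter> space M}"
      by (simp add: emeasure_distr[OF meas E])
    also have "\<dots> = (\<Prod>j\<in>J. emeasure M (f -` F j \<inter> space M))"
      using J f by (intro MS.emeasure_PiM_Collect) auto
    also have "\<dots> = (\<Prod>j\<in>J. emeasure (distr M N f) (F j))"
      using J f by (intro prod.cong) (auto simp: emeasure_distr)
    finally show "emeasure (distr ?S ?T (\<lambda>\<omega> i. f (\<omega> i))) ?E = (\<Prod>j\<in>J. emeasure (distr M N f) (F j))" .
  qed
qed

section \<open>The law of the walk on sequence space\<close>

lemma finite_sets_SL_borel:
  assumes "finite A" "A \<subseteq> SL"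
  shows "A \<in> sets SL_borel"
  using assms unfolding SL_borel_def sets_restrict_space
  by (auto intro!: image_eqI[of _ _ A] borel_closed finite_imp_closed)

lemma SL_prob_measurable_component:
  assumes "SL_prob \<mu>"
  shows "(\<lambda>\<gamma>. \<gamma> i) \<in> (\<Pi>\<^sub>M i\<in>(UNIV :: nat set). \<mu>) \<rightarrow>\<^sub>M SL_borel"
proof -
  let ?S = "\<Pi>\<^sub>M i\<in>(UNIV :: nat set). \<mu>"
  have "(\<lambda>\<gamma>. \<gamma> i) \<in> ?S \<rightarrow>\<^sub>M \<mu>" by measurable
  moreover have "?S \<rightarrow>\<^sub>M \<mu> = ?S \<rightarrow>\<^sub>M SL_borel"
    by (rule measurable_cong_sets) (use assms in \<open>simp_all add: SL_prob_def\<close>)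
  ultimately show ?thesis by simp
qed

lemma measurable_rprod:
  fixes \<mu> :: "(real ^ 'n ^ 'n) measure"
  assumes "SL_prob \<mu>"
  shows "(\<lambda>\<gamma>. rprod \<gamma> n) \<in> (\<Pi>\<^sub>M i\<in>(UNIV :: nat set). \<mu>) \<rightarrow>\<^sub>M SL_borel"
proof (induction n)
  case 0
  have "mat 1 \<in> (SL :: (real ^ 'n ^ 'n) set)" by (simp add: SL_def)
  then show ?case by simp
next
  case (Suc n)
  show ?case
    using measurable_compose[OF measurable_Pair[OF Suc SL_prob_measurable_component[OF assms]] measurable_SL_mult]
    by simp
qed

text \<open>\<open>rprod\<close> grows on the right while \<open>conv_pow\<close> multiplies on the
  left; prepending a step to the sequence reconciles the two.\<close>

lemma rprod_case_nat: "rprod (case_nat g \<gamma>) (Suc n) = g ** rprod \<gamma> n"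
proof (induction n)
  case (Suc n)
  then show ?case by (simp add: matrix_mul_assoc)
qed simp

text \<open>The new left factor is independent of the others, and prepending an independent step to
  an i.i.d. sequence preserves its law (\<open>S.PiM_iter\<close>).\<close>

lemma conv_pow_eq_distr_rprod:
  fixes \<mu> :: "(real ^ 'n ^ 'n) measure"
  assumes "SL_prob \<mu>"
  shows "conv_pow \<mu> n = distr (\<Pi>\<^sub>M i\<in>(UNIV :: nat set). \<mu>) SL_borel (\<lambda>\<gamma>. rprod \<gamma> n)"
proof (induction n)
  interpret prob_space \<mu> using assms by (simp add: SL_prob_def)
  interpret S: sequence_space \<mu> by unfold_locales
  let ?S = "\<Pi>\<^sub>M i\<in>(UNIV :: nat set). \<mu>"
  have sets: "sets \<mu> = sets SL_borel" using assms by (simp add: SL_prob_def)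
  {
    case 0
    have "mat 1 \<in> (SL :: (real ^ 'n ^ 'n) set)" by (simp add: SL_def)
    then show ?case using S.P.prob_space_axioms by (simp add: prob_space.distr_const)
  next
    case (Suc n)
    have meas: "(\<lambda>\<gamma>. rprod \<gamma> m) \<in> ?S \<rightarrow>\<^sub>M SL_borel" for m by (rule measurable_rprod[OF assms])
    interpret P: prob_space "distr ?S SL_borel (\<lambda>\<gamma>. rprod \<gamma> n)"
      by (rule S.P.prob_space_distr[OF meas])
    have id: "(\<lambda>g. g) \<in> \<mu> \<rightarrow>\<^sub>M SL_borel" by (simp add: measurable_ident_sets sets)
    have "\<mu> \<Otimes>\<^sub>M conv_pow \<mu> n = distr \<mu> SL_borel (\<lambda>g. g) \<Otimes>\<^sub>M distr ?S SL_borel (\<lambda>\<gamma>. rprod \<gamma> n)"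
      using Suc by (simp add: distr_id2 sets)
    also have "\<dots> = distr (\<mu> \<Otimes>\<^sub>M ?S) (SL_borel \<Otimes>\<^sub>M SL_borel) (\<lambda>(g, \<gamma>). (g, rprod \<gamma> n))"
      by (rule pair_measure_distr[OF id meas P.sigma_finite_measure_axioms])
    finally have eq: "\<mu> \<Otimes>\<^sub>M conv_pow \<mu> n = \<dots>" .
    have pair: "(\<lambda>(g, \<gamma>). (g, rprod \<gamma> n)) \<in> \<mu> \<Otimes>\<^sub>M ?S \<rightarrow>\<^sub>M SL_borel \<Otimes>\<^sub>M SL_borel"
      unfolding split_beta
      by (intro measurable_Pair measurable_compose[OF measurable_fst id] measurable_compose[OF measurable_snd meas])
    have cons: "(\<lambda>(g, \<gamma>). case_nat g \<gamma>) \<in> \<mu> \<Otimes>\<^sub>M ?S \<rightarrow>\<^sub>M ?S" by measurable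
    have "conv_pow \<mu> (Suc n) = distr (\<mu> \<Otimes>\<^sub>M ?S) SL_borel ((\<lambda>(g, h). g ** h) \<circ> (\<lambda>(g, \<gamma>). (g, rprod \<gamma> n)))"
      by (simp only: conv_pow.simps mconv_def eq distr_distr[OF measurable_SL_mult pair])
    also have "(\<lambda>(g, h). g ** h) \<circ> (\<lambda>(g, \<gamma>). (g, rprod \<gamma> n)) =
        (\<lambda>\<gamma>. rprod \<gamma> (Suc n)) \<circ> (\<lambda>(g, \<gamma>). case_nat g \<gamma>)"
      by (simp only: fun_eq_iff comp_apply split_beta rprod_case_nat fst_conv snd_conv) simp
    also have "distr (\<mu> \<Otimes>\<^sub>M ?S) SL_borel \<dots> = distr ?S SL_borel (\<lambda>\<gamma>. rprod \<gamma> (Suc n))"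
      by (simp only: distr_distr[OF meas cons, symmetric] S.PiM_iter)
    finally show ?case .
  }
qed

lemma walk_law_eq_distr:
  fixes \<mu> :: "(real ^ 'n ^ 'n) measure"
  assumes "SL_prob \<mu>" "x \<in> homog"
  shows "walk_law \<mu> n x = distr (\<Pi>\<^sub>M i\<in>(UNIV :: nat set). \<mu>) homog_borel (\<lambda>\<gamma>. act (rprod \<gamma> n) x)"
  unfolding walk_law_def conv_pow_eq_distr_rprod[OF assms(1)]
  by (simp add: distr_distr[OF measurable_act[OF assms(2)] measurable_rprod[OF assms(1)]] comp_def)

text \<open>On sequence space, divergence along \<open>rprod\<close> says that almost every path
  eventually avoids \<open>M\<close>; the probabilities of hitting \<open>M\<close> at time
  \<open>n\<close> therefore vanish in the limit.\<close>

lemma walk_law_tendsto_0: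
  fixes \<mu> :: "(real ^ 'n ^ 'n) measure"
  assumes \<mu>: "SL_prob \<mu>" and x: "x \<in> homog"
    and AE: "AE \<gamma> in (\<Pi>\<^sub>M i\<in>(UNIV :: nat set). \<mu>). tends_to_infinity (\<lambda>n. act (rprod \<gamma> n) x)"
    and M: "compactin homog_topology M"
  shows "(\<lambda>n. measure (walk_law \<mu> n x) M) \<longlonglongrightarrow> 0"
proof (cases "M \<in> sets homog_borel")
  case True
  interpret prob_space \<mu> using \<mu> by (simp add: SL_prob_def)
  interpret S: sequence_space \<mu> by unfold_locales
  let ?S = "\<Pi>\<^sub>M i\<in>(UNIV :: nat set). \<mu>"
  let ?A = "\<lambda>n. (\<lambda>\<gamma>. act (rprod \<gamma> n) x) -` M \<inter> space ?S"
  have meas: "(\<lambda>\<gamma>. act (rprod \<gamma> n) x) \<in> ?S \<rightarrow>\<^sub>M homog_borel" for n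
    by (rule measurable_compose[OF measurable_rprod[OF \<mu>] measurable_act[OF x]])
  have "(\<lambda>n. measure ?S (?A n)) \<longlonglongrightarrow> 0"
  proof (rule measure_tendsto_0_if_AE_eventually_notin[OF S.P.finite_measure_axioms])
    show "?A n \<in> sets ?S" for n by (rule measurable_sets[OF meas True])
    show "AE \<gamma> in ?S. \<forall>\<^sub>F n in sequentially. \<gamma> \<notin> ?A n"
      using AE
    proof eventually_elim
      case (elim \<gamma>)
      then have "\<forall>\<^sub>F n in sequentially. act (rprod \<gamma> n) x \<notin> M"
        using M by (simp add: tends_to_infinity_def)
      then show ?case by eventually_elim simp
    qed
  qed
  then show ?thesis by (simp add: walk_law_eq_distr[OF \<mu> x] measure_distr[OF meas True])
next
  case False \<comment> \<open>\<open>measure\<close> is 0 on sets that are not measurable\<close>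
  then show ?thesis by (simp add: walk_law_eq_distr[OF \<mu> x] measure_notin_sets)
qed

lemma not_recurrent_in_law:
  assumes "x \<in> homog"
    and "\<And>M. compactin homog_topology M \<Longrightarrow> (\<lambda>n. measure (walk_law \<mu> n x) M) \<longlonglongrightarrow> 0"
  shows "\<not> recurrent_in_law \<mu>"
proof
  assume "recurrent_in_law \<mu>"
  then obtain M n0 where M: "compactin homog_topology M"
      "\<And>n. n \<ge> n0 \<Longrightarrow> measure (walk_law \<mu> n x) M > 1 - 1 / 2"
    using assms(1) unfolding recurrent_in_law_def by (meson half_gt_zero_iff zero_less_one)
  have "\<forall>\<^sub>F n in sequentially. measure (walk_law \<mu> n x) M < 1 / 2"
    using assms(2)[OF M(1)] by (rule order_tendstoD) simp
  then obtain n1 where "\<And>n. n \<ge> n1 \<Longrightarrow> measure (walk_law \<mu> n x) M < 1 / 2"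
    by (auto simp: eventually_sequentially)
  from this[of "max n0 n1"] M(2)[of "max n0 n1"] show False by simp
qed

text \<open>With full support the generated semigroup is \<open>SL\<close> itself, which is the zero
  set of the empty family of polynomials.\<close>

lemma zariski_dense_measureI:
  fixes \<mu> :: "(real ^ 'n ^ 'n) measure"
  assumes "supp \<mu> = SL"
  shows "zariski_dense_measure \<mu>"
proof -
  have "g \<in> SL" if "g \<in> semigroup_gen SL" for g :: "real ^ 'n ^ 'n"
    using that by induction (auto intro: SL_mult)
  then have "semigroup_gen SL = (SL :: (real ^ 'n ^ 'n) set)" by (auto intro: semigroup_gen.base)
  moreover have "zariski_closed (SL :: (real ^ 'n ^ 'n) set)" unfolding zariski_closed_def by (intro exI[of _ "{}"]) auto
  ultimately show ?thesis
    by (simp add: zariski_dense_measure_def zariski_dense_def assms hull_same)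
qed

text \<open>A compact set has a positive lower bound for vector lengths, and
  \<open>1 / real (Suc n)\<close> eventually falls below it. The base point is the standard lattice,
  so \<open>g n\<close> carries it to \<open>coset (g n)\<close>.\<close>

lemma short_vectors_tend_to_infinity:
  fixes g :: "nat \<Rightarrow> real ^ 'n ^ 'n"
  assumes "\<forall>\<^sub>F n in sequentially. short_vector (1 / real (Suc n)) (g n)"
  shows "tends_to_infinity (\<lambda>n. act (g n) (coset (mat 1)))"
  unfolding tends_to_infinity_def
proof safe
  fix M :: "(real ^ 'n ^ 'n) set set" assume M: "compactin homog_topology M"
  obtain \<epsilon> where \<epsilon>: "\<epsilon> > 0" "\<And>h v. coset h \<in> M \<Longrightarrow> integer_vec v \<Longrightarrow> v \<noteq> 0 \<Longrightarrow> norm (h *v v) \<ge> \<epsilon>"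
    using compactin_homog_short_vectors[OF M] by blast
  have "\<forall>\<^sub>F n in sequentially. 1 / real (Suc n) < \<epsilon>"
    using order_tendstoD(2)[OF LIMSEQ_inverse_real_of_nat \<epsilon>(1)] by (simp add: inverse_eq_divide)
  with assms show "\<forall>\<^sub>F n in sequentially. act (g n) (coset (mat 1)) \<notin> M"
  proof eventually_elim
    case (elim n)
    then show ?case using \<epsilon>(2)[of "g n"] by (force simp: short_vector_def act_coset)
  qed
qed

lemma short_vector_mprod:
  assumes "length (l @ g # l') \<le> c" "set l \<subseteq> F" "set l' \<subseteq> F"
    and "\<And>A B. A \<in> words c F \<Longrightarrow> B \<in> words c F \<Longrightarrow> short_vector \<epsilon> (A ** g ** B)"
  shows "short_vector \<epsilon> (mprod (l @ g # l'))"
proof -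
  have "mprod l \<in> words c F" "mprod l' \<in> words c F"
    using assms(1-3) by (auto simp: words_def)
  then show ?thesis using assms(4) by (simp add: matrix_mul_assoc)
qed

text \<open>Cutting the product at step \<open>m\<close> leaves a word on either side. Reversing the
  order only reverses and swaps these words, so one hypothesis covers both products.\<close>

lemma short_vector_rprod_lprod:
  assumes "m < n" "n \<le> c" "\<And>i. i < n \<Longrightarrow> i \<noteq> m \<Longrightarrow> \<gamma> i \<in> F"
    and "\<And>A B. A \<in> words c F \<Longrightarrow> B \<in> words c F \<Longrightarrow> short_vector \<epsilon> (A ** \<gamma> m ** B)"
  shows "short_vector \<epsilon> (rprod \<gamma> n)" "short_vector \<epsilon> (lprod \<gamma> n)"
proof -
  let ?l = "map \<gamma> [0..<m]" and ?l' = "map \<gamma> [Suc m..<n]"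
  have "[0..<n] = [0..<m] @ m # [Suc m..<n]"
    using upt_add_eq_append[of 0 m "n - m"] upt_conv_Cons[OF assms(1)] assms(1) by simp
  then have eq: "map \<gamma> [0..<n] = ?l @ \<gamma> m # ?l'" by simp
  have F: "set ?l \<subseteq> F" "set ?l' \<subseteq> F" using assms(1,3) by auto
  have len: "length (?l @ \<gamma> m # ?l') \<le> c" using assms(1,2) by simp
  show "short_vector \<epsilon> (rprod \<gamma> n)"
    unfolding rprod_eq_mprod eq using len F assms(4) by (rule short_vector_mprod)
  have "short_vector \<epsilon> (mprod (rev ?l' @ \<gamma> m # rev ?l))"
    using len F assms(4) by (intro short_vector_mprod[where c = c and F = F]) auto
  then show "short_vector \<epsilon> (lprod \<gamma> n)" unfolding lprod_eq_mprod eq by simp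
qed

section \<open>The step distribution and divergence of both products\<close>

theorem theorem1p1:
  assumes "CARD('n::finite) \<ge> 2"
  shows "\<exists>(\<mu> :: (real ^ 'n ^ 'n) measure) x.
    SL_prob \<mu> \<and> zariski_dense_measure \<mu> \<and> x \<in> homog \<and>
    (AE \<gamma> in (\<Pi>\<^sub>M i\<in>(UNIV :: nat set). \<mu>).
       tends_to_infinity (\<lambda>n. act (rprod \<gamma> n) x) \<and>
       tends_to_infinity (\<lambda>n. act (lprod \<gamma> n) x)) \<and>
    (\<forall>M. compactin homog_topology M \<longrightarrow> (\<lambda>n. measure (walk_law \<mu> n x) M) \<longlonglongrightarrow> 0) \<and>
    \<not> recurrent_in_law \<mu>"
proof -
  define b :: "nat \<Rightarrow> real ^ 'n ^ 'n" where "b = from_nat_into SLQ"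
  have b: "range b = SLQ"
    unfolding b_def using mat_1_SLQ by (intro range_from_nat_into countable_SLQ) auto
  \<comment> \<open>The word length \<open>(k + 2)\<^sup>2\<close> matches the bound on
    \<open>n\<close> in \<open>AE_rec_dominated\<close>.\<close>
  obtain G :: "nat \<Rightarrow> real ^ 'n ^ 'n" where GQ: "\<And>k. G k \<in> SLQ" and Gb: "\<And>j. G (j\<^sup>2) = b j"
    and short: "\<And>k A B. k \<notin> range power2 \<Longrightarrow> A \<in> words ((k + 2)\<^sup>2) (G ` {..<k}) \<Longrightarrow>
      B \<in> words ((k + 2)\<^sup>2) (G ` {..<k}) \<Longrightarrow> short_vector (1 / real (Suc ((k + 2)\<^sup>2))) (A ** G k ** B)"
    using dominating_sequence[of b "\<lambda>k. (k + 2)\<^sup>2"] assms b by auto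
  have GSL: "G k \<in> SL" for k using GQ SLQ_subset_SL by auto
  define \<mu> :: "(real ^ 'n ^ 'n) measure" where "\<mu> = distr (measure_pmf rec_pmf) SL_borel G"
  have G: "G \<in> measure_pmf rec_pmf \<rightarrow>\<^sub>M SL_borel" using GSL by simp
  have \<mu>: "SL_prob \<mu>"
    unfolding SL_prob_def \<mu>_def using measure_pmf.prob_space_distr[OF G] by simp
  have "supp \<mu> = SL"
  proof -
    \<comment> \<open>A nonempty open subset of \<open>SL\<close> contains a rational matrix, which
      occurs as some \<open>G (j\<^sup>2)\<close> and thus has positive mass.\<close>
    have "emeasure \<mu> U > 0" if U: "openin (top_of_set SL) U" "g \<in> U" for g U
    proof -
      obtain T where T: "open T" "U = SL \<inter> T" using U(1) by (auto simp: openin_open)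
      then have "g \<in> closure SLQ" using U(2) SL_subset_closure_SLQ by auto
      then obtain h where h: "h \<in> SLQ" "h \<in> T"
        using T U(2) unfolding closure_iff_nhds_not_empty by (metis Int_iff disjoint_iff order_refl)
      then obtain j where j: "G (j\<^sup>2) \<in> T" using b Gb by (metis imageE)
      have "U \<in> sets SL_borel" using T by (auto simp: SL_borel_def sets_restrict_space)
      then have eq: "emeasure \<mu> U = emeasure rec_pmf (G -` U)"
        unfolding \<mu>_def by (simp add: emeasure_distr[OF G])
      have "0 < emeasure rec_pmf {j\<^sup>2}"
        by (simp add: emeasure_pmf_single pmf_rec_pmf add_pos_nonneg)
      also have "\<dots> \<le> emeasure \<mu> U"
        unfolding eq using j GSL T(2) by (intro emeasure_mono) auto
      finally show ?thesis .
    qed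
    then show ?thesis by (auto simp: supp_def)
  qed
  then have zd: "zariski_dense_measure \<mu>" by (rule zariski_dense_measureI)
  define x :: "(real ^ 'n ^ 'n) set" where "x = coset (mat 1)"
  have x: "x \<in> homog" unfolding x_def homog_def by (intro imageI) (simp add: SL_def)
  let ?S = "\<Pi>\<^sub>M i\<in>(UNIV :: nat set). \<mu>"
  \<comment> \<open>Domination is expressed through the matrices alone, since \<open>G\<close> need
    not be injective and \<gamma> need not determine the indices. It combines countably many
    memberships in finite sets, so it is measurable, as the transfer through
    \<open>AE_distr_iff\<close> demands.\<close>
  let ?good = "\<lambda>\<gamma>. \<forall>\<^sub>F n in sequentially. \<exists>m<n. \<exists>k. k \<notin> range power2 \<and> n \<le> (k + 2)\<^sup>2 \<and>
     \<gamma> m \<in> {G k} \<and> (\<forall>i<n. i \<noteq> m \<longrightarrow> \<gamma> i \<in> G ` {..<k})"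
  have good: "AE \<gamma> in ?S. ?good \<gamma>"
  proof -
    let ?T = "\<Pi>\<^sub>M i\<in>(UNIV :: nat set). (SL_borel :: (real ^ 'n ^ 'n) measure)"
    have meas: "(\<lambda>\<omega> i. G (\<omega> i)) \<in> rec_space \<rightarrow>\<^sub>M ?T" by (rule measurable_map_sequence[OF G])
    have pred_mem: "Measurable.pred ?T (\<lambda>\<gamma>. \<gamma> i \<in> A)" if "finite A" "A \<subseteq> SL" for i :: nat and A
    proof -
      have "(\<lambda>\<gamma>. \<gamma> i) \<in> ?T \<rightarrow>\<^sub>M SL_borel" by (rule measurable_component_singleton) simp
      with finite_sets_SL_borel[OF that] show ?thesis by (rule pred_sets2)
    qed
    have [measurable]: "Measurable.pred ?T (\<lambda>\<gamma>. \<gamma> i \<in> {G k})" "Measurable.pred ?T (\<lambda>\<gamma>. \<gamma> i \<in> G ` {..<k})"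
      for i k by (rule pred_mem, simp, use GSL in blast)+
    have "Measurable.pred ?T ?good" unfolding eventually_sequentially by measurable
    moreover have "AE \<omega> in rec_space. ?good (\<lambda>i. G (\<omega> i))"
      using AE_rec_dominated
    proof eventually_elim
      case (elim \<omega>)
      then show ?case
      proof eventually_elim
        case (elim n)
        then show ?case by blast
      qed
    qed
    ultimately show ?thesis
      unfolding \<mu>_def PiM_distr_sequence[OF measure_pmf.prob_space_axioms G]
      by (simp only: AE_distr_iff[OF meas] pred_def)
  qed
  have AE: "AE \<gamma> in ?S. tends_to_infinity (\<lambda>n. act (rprod \<gamma> n) x) \<and> tends_to_infinity (\<lambda>n. act (lprod \<gamma> n) x)"
    using good
  proof eventually_elim
    case (elim \<gamma>)
    then have "\<forall>\<^sub>F n in sequentially. short_vector (1 / real (Suc n)) (rprod \<gamma> n) \<and>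
      short_vector (1 / real (Suc n)) (lprod \<gamma> n)"
    proof eventually_elim
      case (elim n)
      then obtain m k where mk: "m < n" "k \<notin> range power2" "n \<le> (k + 2)\<^sup>2" "\<gamma> m = G k"
        "\<And>i. i < n \<Longrightarrow> i \<noteq> m \<Longrightarrow> \<gamma> i \<in> G ` {..<k}" by blast
      \<comment> \<open>Since \<open>n \<le> (k + 2)\<^sup>2\<close>, the bound chosen for level
        \<open>k\<close> is at least as strong as the one wanted at time \<open>n\<close>.\<close>
      have "real (Suc n) \<le> real (Suc ((k + 2)\<^sup>2))"
        using mk(3) by (simp only: of_nat_le_iff Suc_le_mono)
      then have le: "1 / real (Suc ((k + 2)\<^sup>2)) \<le> 1 / real (Suc n)"
        by (rule frac_le[rotated 3]) simp_all
      have "short_vector (1 / real (Suc n)) (A ** \<gamma> m ** B)"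
        if "A \<in> words ((k + 2)\<^sup>2) (G ` {..<k})" "B \<in> words ((k + 2)\<^sup>2) (G ` {..<k})" for A B
        using short[OF mk(2) that] le unfolding short_vector_def mk(4) by (meson order_trans)
      then show ?case
        using short_vector_rprod_lprod[where \<gamma> = \<gamma> and F = "G ` {..<k}", OF mk(1,3,5)] by blast
    qed
    then show ?case
      unfolding x_def by (auto intro!: short_vectors_tend_to_infinity elim: eventually_mono)
  qed
  then have "AE \<gamma> in ?S. tends_to_infinity (\<lambda>n. act (rprod \<gamma> n) x)" by eventually_elim simp
  then have conv: "(\<lambda>n. measure (walk_law \<mu> n x) M) \<longlonglongrightarrow> 0" if "compactin homog_topology M" for M
    using walk_law_tendsto_0[OF \<mu> x _ that] by simp
  have "\<not> recurrent_in_law \<mu>" by (rule not_recurrent_in_law[OF x conv])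
  then show ?thesis using \<mu> zd x AE conv by (intro exI[of _ \<mu>] exI[of _ x]) simp
qed

end
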